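(* The symbolic dynamical system $(\{1,2\}^{\mathbb{N}},S)$ is a symbolic representation of $(\Delta,f_C)$. More precisely: (1) for any shift-invariant Borel probability measure $\mu$ on $\{1,2\}^{\mathbb{N}}$ such that $\mu(\mathcal{P})=1$, the map $\pi:(\{1,2\}^{\mathbb{N}},S,\mu)\to(\Delta,f_C,\pi_*\mu)$ is a measure-preserving isomorphism; (2) for any $f_C$-invariant Borel probability measure $\nu$ on $\Delta$ such that $\nu(\mathcal{I})=1$, the map $\pi:(\{1,2\}^{\mathbb{N}},S,\pi^{-1}_*\nu)\to(\Delta,f_C,\nu)$ is a measure-preserving isomorphism.
   Context: Let $C_1=\begin{pmatrix}1&1&0\\0&0&1\\0&1&0\end{pmatrix}$ and $C_2=\begin{pmatrix}0&1&0\\1&0&0\\0&1&1\end{pmatrix}$. Let $\Delta=\{\mathbf{x}\in\mathbb{R}^3_{\geq 0}\mid \|\mathbf{x}\|_1=1\}$. The map $F_C:\mathbb{R}^3_{\ge0}\to\mathbb{R}^3_{\ge0}$ is $F_C(\mathbf{x})=C_1^{-1}\mathbf{x}=(x_1-x_3,x_3,x_2)$ if $x_1\ge x_3$, and $F_C(\mathbf{x})=C_2^{-1}\mathbf{x}=(x_2,x_1,x_3-x_1)$ if $x_1<x_3$. The map $f_C:\Delta\to\Delta$ is $f_C(\mathbf{x})=F_C(\mathbf{x})/\|F_C(\mathbf{x})\|_1$. The shift $S$ on $\{1,2\}^{\mathbb{N}}$ is $S((i_n)_{n})=(i_{n+1})_{n}$, and $\{1,2\}^{\mathbb{N}}$ has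 the product topology; all spaces carry their Borel $\sigma$-algebras. For every $(i_n)_{n\in\mathbb{N}}\in\{1,2\}^{\mathbb{N}}$ the cone $\bigcap_{n\ge0}C_{i_0}C_{i_1}\cdots C_{i_n}\mathbb{R}^3_{\ge0}$ is a half-line, and $\pi((i_n)_n)$ is defined as its unique element in $\Delta$; this defines a continuous map $\pi:\{1,2\}^{\mathbb{N}}\to\Delta$. A sequence $(M_n)_{n\in\mathbb{N}}$ of nonnegative square matrices of the same size is primitive if for all $r\in\mathbb{N}$ there is $s>r$ such that $M_rM_{r+1}\cdots M_{s-1}$ has only positive entries. $\mathcal{P}$ is the set of $(i_n)_n\in\{1,2\}^{\mathbb{N}}$ such that $(C_{i_n})_n$ is primitive. $\mathcal{I}$ is the set of vectors of $\Delta$ whose three entries are linearly independent over $\mathbb{Q}$. The restriction of $\pi$ to $\mathcal{P}$ is a bijection $\mathcal{P}\to\mathcal{I}$. Here $\pi_*\mu(B)=\mu(\pi^{-1}(B))$ is the pushforward measure, and $\pi^{-1}_*\nu$ is the pushforward of $\nu$ (which is carried by $\mathcal{I}$) under the inverse of $\pi:\mathcal{P}\to\mathcal{I}$. Given measure-preserving systems $(X,T,\mu)$ and $(Y,R,\nu)$ (probability spaces with measure-preserving self-maps), a map $\pi$ is a measure-preserving isomorphism between them if there are measurable sets $\tilde X\subset X$, $\tilde Y\subset Y$ of measure $1$ with $T(\tilde X)\subset\tilde X$, $R(\tilde Y)\subset\tilde Y$, such that $\pi$ restricts to a bijection $\tilde X\to\tilde Y$ that is measurable with measurable inverse, is measure-preserving,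 and satisfies $\pi\circ T(x)=R\circ\pi(x)$ for all $x\in\tilde X$. *)

theory Defs
  imports "HOL-Probability.Probability"
begin

definition invariant_measure :: "'a measure \<Rightarrow> ('a \<Rightarrow> 'a) \<Rightarrow> bool" where
  "invariant_measure M T \<longleftrightarrow> T \<in> measurable M M \<and> distr M M T = M"

definition mp_system :: "'a measure \<Rightarrow> ('a \<Rightarrow> 'a) \<Rightarrow> bool" where
  "mp_system M T \<longleftrightarrow> prob_space M \<and> invariant_measure M T"

definition mp_isomorphism ::
    "'a measure \<Rightarrow> ('a \<Rightarrow> 'a) \<Rightarrow> 'b measure \<Rightarrow> ('b \<Rightarrow> 'b) \<Rightarrow> ('a \<Rightarrow> 'b) \<Rightarrow> bool" where
  "mp_isomorphism M T N R \<phi> \<longleftrightarrow>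
     mp_system M T \<and> mp_system N R \<and> \<phi> \<in> space M \<rightarrow> space N \<and>
     (\<exists>X\<in>sets M. \<exists>Y\<in>sets N.
        emeasure M X = 1 \<and> emeasure N Y = 1 \<and>
        T ` X \<subseteq> X \<and> R ` Y \<subseteq> Y \<and>
        bij_betw \<phi> X Y \<and>
        \<phi> \<in> measurable (restrict_space M X) (restrict_space N Y) \<and>
        the_inv_into X \<phi> \<in> measurable (restrict_space N Y) (restrict_space M X) \<and>
        distr (restrict_space M X) (restrict_space N Y) \<phi> = restrict_space N Y \<and>
        (\<forall>x\<in>X. \<phi> (T x) = R (\<phi> x)))"

text \<open>\<^term>\<open>mat_prod M r s\<close> is the product \<open>M r ** M (r + 1) ** \<dots> ** M (s - 1)\<close>, in this order.\<close>

definition mat_prod :: "(nat \<Rightarrow> real^'n^'n) \<Rightarrow> nat \<Rightarrow> nat \<Rightarrow> real^'n^'n" where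
  "mat_prod M r s = foldr (\<lambda>n A. M n ** A) [r..<s] (mat 1)"

definition primitive_seq :: "(nat \<Rightarrow> real^'n^'n) \<Rightarrow> bool" where
  "primitive_seq M \<longleftrightarrow>
     (\<forall>n i j. 0 \<le> M n $ i $ j) \<and>
     (\<forall>r. \<exists>s>r. \<forall>i j. 0 < mat_prod M r s $ i $ j)"

definition C1 :: "real^3^3" where
  "C1 = vector [vector [1, 1, 0], vector [0, 0, 1], vector [0, 1, 0]]"

definition C2 :: "real^3^3" where
  "C2 = vector [vector [0, 1, 0], vector [1, 0, 0], vector [0, 1, 1]]"

text \<open>Only the indices \<open>1\<close> and \<open>2\<close> are relevant.\<close>

definition C_mat :: "nat \<Rightarrow> real^3^3" where
  "C_mat i = (if i = 1 then C1 else C2)"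

definition nonneg_cone :: "(real^3) set" where
  "nonneg_cone = {x. \<forall>i. 0 \<le> x $ i}"

definition l1_norm :: "real^3 \<Rightarrow> real" where
  "l1_norm x = (\<Sum>i\<in>UNIV. \<bar>x $ i\<bar>)"

definition simplex3 :: "(real^3) set" where
  "simplex3 = {x \<in> nonneg_cone. l1_norm x = 1}"

text \<open>The next two maps are meant on \<^term>\<open>nonneg_cone\<close> and \<^term>\<open>simplex3\<close>, respectively.\<close>

definition F_C :: "real^3 \<Rightarrow> real^3" where
  "F_C x = (if x $ 1 \<ge> x $ 3 then matrix_inv C1 *v x else matrix_inv C2 *v x)"

definition f_C :: "real^3 \<Rightarrow> real^3" where
  "f_C x = (1 / l1_norm (F_C x)) *\<^sub>R F_C x"

definition simplex_borel :: "(real^3) measure" where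
  "simplex_borel = restrict_space borel simplex3"

text \<open>Linear independence over the rationals of the entries as a family, so that the three entries
  are in particular distinct.\<close>

definition rat_indep_simplex :: "(real^3) set" where
  "rat_indep_simplex =
     {x \<in> simplex3. \<forall>q :: 3 \<Rightarrow> rat. (\<Sum>i\<in>UNIV. of_rat (q i) * x $ i) = 0 \<longrightarrow> (\<forall>i. q i = 0)}"

text \<open>\<^typ>\<open>nat \<Rightarrow> nat\<close> carries the product of the discrete topologies;
  it induces the product topology on the closed subset \<open>seqs12\<close>.\<close>

definition seqs12 :: "(nat \<Rightarrow> nat) set" where
  "seqs12 = UNIV \<rightarrow> {1, 2}"

definition seqs12_borel :: "(nat \<Rightarrow> nat) measure" where
  "seqs12_borel = restrict_space borel seqs12"

definition shift_map :: "(nat \<Rightarrow> nat) \<Rightarrow> (nat \<Rightarrow> nat)" where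
  "shift_map i = (\<lambda>n. i (Suc n))"

definition primitive_seqs :: "(nat \<Rightarrow> nat) set" where
  "primitive_seqs = {i \<in> seqs12. primitive_seq (\<lambda>n. C_mat (i n))}"

definition limit_cone :: "(nat \<Rightarrow> nat) \<Rightarrow> (real^3) set" where
  "limit_cone i = (\<Inter>n. (\<lambda>x. mat_prod (\<lambda>k. C_mat (i k)) 0 (Suc n) *v x) ` nonneg_cone)"

definition pi_map :: "(nat \<Rightarrow> nat) \<Rightarrow> real^3" where
  "pi_map i = (THE x. x \<in> limit_cone i \<and> x \<in> simplex3)"

definition pi_push :: "(nat \<Rightarrow> nat) measure \<Rightarrow> (real^3) measure" where
  "pi_push \<mu> = distr \<mu> simplex_borel pi_map"

text \<open>The inverse of \<^term>\<open>pi_map\<close> is only meaningful on \<^term>\<open>rat_indep_simplex\<close>, so \<open>\<nu>\<close> is first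
  restricted to that set; nothing is lost when the set has full measure.\<close>

definition pi_inv_push :: "(real^3) measure \<Rightarrow> (nat \<Rightarrow> nat) measure" where
  "pi_inv_push \<nu> =
     distr (restrict_space \<nu> rat_indep_simplex) seqs12_borel (the_inv_into primitive_seqs pi_map)"

lemma matrix_inv_eqI:
  fixes A B :: "real^'n^'n"
  assumes "A ** B = mat 1" "B ** A = mat 1"
  shows "matrix_inv A = B"
proof -
  have "A ** matrix_inv A = mat 1 \<and> matrix_inv A ** A = mat 1"
    unfolding matrix_inv_def by (rule someI[of _ B]) (use assms in auto)
  then have "matrix_inv A ** (A ** B) = B" by (simp add: matrix_mul_assoc)
  then show ?thesis by (simp add: assms)
qed

lemma matrix_inv_C1: "matrix_inv C1 = vector [vector [1, 0, -1], vector [0, 0, 1], vector [0, 1, 0]]"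
  by (rule matrix_inv_eqI)
    (simp_all add: C1_def vec_eq_iff forall_3 matrix_matrix_mult_def sum_3 mat_def)

lemma matrix_inv_C2: "matrix_inv C2 = vector [vector [0, 1, 0], vector [1, 0, 0], vector [-1, 0, 1]]"
  by (rule matrix_inv_eqI)
    (simp_all add: C2_def vec_eq_iff forall_3 matrix_matrix_mult_def sum_3 mat_def)

lemma F_C_coordinates:
  "F_C x = (if x $ 1 \<ge> x $ 3 then vector [x $ 1 - x $ 3, x $ 3, x $ 2]
            else vector [x $ 2, x $ 1, x $ 3 - x $ 1])"
  by (simp add: F_C_def matrix_inv_C1 matrix_inv_C2 vec_eq_iff forall_3 matrix_vector_mult_def sum_3)

end

theory Submission
  imports Defs
begin

text \<open>
  The \<open>F_C\<close>-orbit of a point of the limit cone of \<open>i\<close> pairs with the row vectors obtained by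
  multiplying \<open>n\<close> from the right by \<open>C_mat (i 0)\<close>, \<open>C_mat (i 1)\<close>, \<dots>, and the pairing
  is constant. If \<open>n\<close> is orthogonal to some \<open>x\<close> in the limit cone, its entries never all have the
  same strict sign, which forces the maximum of the absolute values of the six forms \<open>n1\<close>, \<open>n3\<close>,
  \<open>n1 - n2\<close>, \<open>n2 - n3\<close>, \<open>n1 - n3\<close>, \<open>n2 - n1 - n3\<close> not to increase. The row vectors therefore stay
  bounded, whereas the orbit of every other point of the limit cone tends to 0 (unless \<open>i\<close> is
  eventually constant), so \<open>n\<close> is orthogonal to the whole limit cone, which is thus a half-line.

  A sequence is primitive iff it is not eventually a concatenation of the blocks 11 and 22. For such
  a sequence the maximum above eventually drops strictly, so that no nonzero integral \<open>n\<close> can be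
  orthogonal to \<open>x\<close>. Conversely, along blocks 11 and 22 the second coordinate of the orbit is
  constant and each block subtracts it from the sum of the other two, so it must vanish.
  The inverse of \<open>pi_map\<close> is the itinerary map, and \<open>pi_map\<close> is a pointwise limit of functions
  of finitely many symbols; both are therefore measurable.
\<close>

section \<open>Orbits\<close>

text \<open>\<open>pull a\<close> multiplies column vectors by the inverse of \<open>C_mat a\<close>; \<open>pushfwd a\<close> multiplies
  row vectors by \<open>C_mat a\<close> from the right.\<close>

definition pull :: "nat \<Rightarrow> real^3 \<Rightarrow> real^3" where
  "pull a x = (if a = 1 then vector [x $ 1 - x $ 3, x $ 3, x $ 2]
               else vector [x $ 2, x $ 1, x $ 3 - x $ 1])"

definition pushfwd :: "nat \<Rightarrow> real^3 \<Rightarrow> real^3" where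
  "pushfwd a n = (if a = 1 then vector [n $ 1, n $ 1 + n $ 3, n $ 2]
                 else vector [n $ 2, n $ 1 + n $ 3, n $ 3])"

primrec orb :: "(nat \<Rightarrow> nat) \<Rightarrow> real^3 \<Rightarrow> nat \<Rightarrow> real^3" where
  "orb i x 0 = x"
| "orb i x (Suc k) = pull (i k) (orb i x k)"

primrec corb :: "(nat \<Rightarrow> nat) \<Rightarrow> real^3 \<Rightarrow> nat \<Rightarrow> real^3" where
  "corb i n 0 = n"
| "corb i n (Suc k) = pushfwd (i k) (corb i n k)"

lemma inner_3: "(n::real^3) \<bullet> x = n $ 1 * x $ 1 + n $ 2 * x $ 2 + n $ 3 * x $ 3"
  by (simp add: inner_vec_def sum_3)

lemma mem_nonneg_cone: "x \<in> nonneg_cone \<longleftrightarrow> 0 \<le> x $ 1 \<and> 0 \<le> x $ 2 \<and> 0 \<le> x $ 3"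
  by (simp add: nonneg_cone_def forall_3)

lemma l1_norm_3: "l1_norm x = \<bar>x $ 1\<bar> + \<bar>x $ 2\<bar> + \<bar>x $ 3\<bar>"
  by (simp add: l1_norm_def sum_3)

lemma mem_simplex3:
  "x \<in> simplex3 \<longleftrightarrow> 0 \<le> x $ 1 \<and> 0 \<le> x $ 2 \<and> 0 \<le> x $ 3 \<and> x $ 1 + x $ 2 + x $ 3 = 1"
  by (auto simp: simplex3_def mem_nonneg_cone l1_norm_3)

lemma C_mat_coordinates:
  "C_mat a *v x = (if a = 1 then vector [x $ 1 + x $ 2, x $ 3, x $ 2]
                   else vector [x $ 2, x $ 1, x $ 2 + x $ 3])"
  by (simp add: C_mat_def C1_def C2_def vec_eq_iff forall_3 matrix_vector_mult_def sum_3)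

lemma C_mat_pull [simp]: "C_mat a *v pull a x = x"
  by (simp add: C_mat_coordinates pull_def vec_eq_iff forall_3)

lemma pull_C_mat [simp]: "pull a (C_mat a *v x) = x"
  by (simp add: C_mat_coordinates pull_def vec_eq_iff forall_3)

lemma C_mat_nonneg_cone: "x \<in> nonneg_cone \<Longrightarrow> C_mat a *v x \<in> nonneg_cone"
  by (simp add: C_mat_coordinates mem_nonneg_cone)

lemma pull_nonneg_cone_D: "pull a x \<in> nonneg_cone \<Longrightarrow> x \<in> nonneg_cone"
  using C_mat_nonneg_cone[of "pull a x" a] by simp

lemma pull_scaleR: "pull a (c *\<^sub>R x) = c *\<^sub>R pull a x"
  by (simp add: pull_def vec_eq_iff forall_3 algebra_simps)

lemma pushfwd_inner_pull: "pushfwd a n \<bullet> pull a x = n \<bullet> x"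
  by (simp add: pushfwd_def pull_def inner_3 algebra_simps)

lemma corb_inner_orb: "corb i n k \<bullet> orb i x k = n \<bullet> x"
  by (induction k) (simp_all add: pushfwd_inner_pull)

lemma orb_scaleR: "orb i (c *\<^sub>R x) k = c *\<^sub>R orb i x k"
  by (induction k) (simp_all add: pull_scaleR)

lemma orb_nonneg_cone_mono:
  assumes "orb i x l \<in> nonneg_cone" "k \<le> l"
  shows "orb i x k \<in> nonneg_cone"
  using assms(2,1) by (induction rule: dec_induct) (auto dest: pull_nonneg_cone_D)

lemma continuous_pull: "continuous_on UNIV (pull a)"
proof -
  have "pull a = (\<lambda>x. matrix_inv (C_mat a) *v x)"
    by (rule ext) (simp add: pull_def C_mat_def matrix_inv_C1 matrix_inv_C2 vec_eq_iff forall_3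
        matrix_vector_mult_def sum_3)
  then show ?thesis by (simp add: matrix_vector_mult_linear_continuous_on)
qed

lemma continuous_orb: "continuous_on UNIV (\<lambda>x. orb i x k)"
  by (induction k) (auto intro: continuous_on_compose2[OF continuous_pull])

lemma orb_eq_0_iff: "orb i x k = 0 \<longleftrightarrow> x = 0"
proof (induction k)
  case (Suc k)
  have "pull a y = 0 \<longleftrightarrow> y = 0" for a y
    by (auto simp: pull_def vec_eq_iff forall_3)
  with Suc show ?case by simp
qed simp

lemma corb_eq_0_iff: "corb i x k = 0 \<longleftrightarrow> x = 0"
proof (induction k)
  case (Suc k)
  have "pushfwd a y = 0 \<longleftrightarrow> y = 0" for a y
    by (auto simp: pushfwd_def vec_eq_iff forall_3)
  with Suc show ?case by simp
qed simp

lemma orb_Suc_shift: "orb i x (Suc k) = orb (shift_map i) (pull (i 0) x) k"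
  by (induction k) (simp_all add: shift_map_def)

lemma orb_add: "orb i x (r + k) = orb (\<lambda>n. i (r + n)) (orb i x r) k"
  by (induction k) simp_all

section \<open>Matrix products in terms of orbits\<close>

lemma foldr_matrix_mult:
  "foldr (\<lambda>n A. M n ** A) xs (B :: real^'n^'n) = foldr (\<lambda>n A. M n ** A) xs (mat 1) ** B"
proof (induction xs)
  case (Cons a xs)
  show ?case by (simp only: foldr.simps o_apply Cons matrix_mul_assoc)
qed simp

lemma mat_prod_self: "mat_prod M r r = mat 1"
  by (simp add: mat_prod_def)

lemma mat_prod_Suc:
  assumes "r \<le> k"
  shows "mat_prod M r (Suc k) = mat_prod M r k ** M k"
  using assms foldr_matrix_mult[of M "[r..<k]" "M k"] by (simp add: mat_prod_def)

text \<open>Right multiplication by \<open>C_mat a\<close> acts on every row as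
  \<open>pushfwd a\<close>, and the rows of the identity are the unit vectors. Positivity of a
  product thus becomes positivity of the row orbits of the unit vectors.\<close>

lemma mat_prod_row:
  "mat_prod (\<lambda>n. C_mat (i n)) r (r + k) $ j = corb (\<lambda>n. i (r + n)) (axis j 1) k"
proof (induction k)
  case 0
  then show ?case by (simp add: mat_prod_self vec_eq_iff mat_def axis_def)
next
  case (Suc k)
  have "(A ** C_mat a) $ j = pushfwd a (A $ j)" for a and A :: "real^3^3"
    by (simp add: vec_eq_iff forall_3 matrix_matrix_mult_def sum_3 C_mat_def C1_def C2_def
        pushfwd_def)
  with Suc show ?case by (simp add: mat_prod_Suc)
qed

lemma mat_prod_eq_iff_orb:
  "mat_prod (\<lambda>n. C_mat (i n)) 0 k *v z = x \<longleftrightarrow> z = orb i x k"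
proof (induction k arbitrary: z)
  case 0
  then show ?case by (simp add: mat_prod_self)
next
  case (Suc k)
  have "mat_prod (\<lambda>n. C_mat (i n)) 0 (Suc k) *v z = x \<longleftrightarrow> C_mat (i k) *v z = orb i x k"
    by (simp add: mat_prod_Suc matrix_vector_mul_assoc[symmetric] Suc)
  also have "\<dots> \<longleftrightarrow> z = orb i x (Suc k)"
    by (metis C_mat_pull pull_C_mat orb.simps(2))
  finally show ?case .
qed

lemma mem_limit_cone: "x \<in> limit_cone i \<longleftrightarrow> (\<forall>k. orb i x k \<in> nonneg_cone)"
proof -
  have "x \<in> (\<lambda>x. mat_prod (\<lambda>n. C_mat (i n)) 0 k *v x) ` nonneg_cone \<longleftrightarrow> orb i x k \<in> nonneg_cone"
    for k
    unfolding image_iff by (metis mat_prod_eq_iff_orb)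
  then have "x \<in> limit_cone i \<longleftrightarrow> (\<forall>k. orb i x (Suc k) \<in> nonneg_cone)"
    by (simp add: limit_cone_def)
  \<comment> \<open>The products in \<open>limit_cone\<close> have at least one factor; index 0 is
    recovered because nonnegativity passes back along the orbit.\<close>
  then show ?thesis
    by (meson orb_nonneg_cone_mono le_add2 plus_1_eq_Suc le_SucI order_refl)
qed

section \<open>The limit cone is a half-line\<close>

lemma inner_pos_nonneg_eq_0:
  fixes n z :: "real^3"
  assumes "\<And>j. 0 < n $ j" "z \<in> nonneg_cone" "n \<bullet> z = 0"
  shows "z = 0"
proof -
  have "\<forall>j. n $ j * z $ j = 0"
    using assms sum_nonneg_eq_0_iff[of UNIV "\<lambda>j. n $ j * z $ j"]
    by (auto simp: inner_vec_def nonneg_cone_def less_imp_le)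
  moreover have "n $ j \<noteq> 0" for j using assms(1)[of j] by simp
  ultimately show ?thesis by (simp add: vec_eq_iff)
qed

text \<open>Up to sign, the six forms at \<open>pushfwd a n\<close> take the value
  \<open>n $ 2\<close> and the values at \<open>n\<close> of all forms except
  \<open>n $ 1 - n $ 3\<close>. A bound thus propagates as soon as \<open>n $ 2\<close> is
  controlled.\<close>

definition six_le :: "real \<Rightarrow> real^3 \<Rightarrow> bool" where
  "six_le B n \<longleftrightarrow> \<bar>n $ 1\<bar> \<le> B \<and> \<bar>n $ 3\<bar> \<le> B \<and> \<bar>n $ 1 - n $ 2\<bar> \<le> B \<and> \<bar>n $ 2 - n $ 3\<bar> \<le> B \<and>
     \<bar>n $ 1 - n $ 3\<bar> \<le> B \<and> \<bar>n $ 2 - n $ 1 - n $ 3\<bar> \<le> B"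

lemma six_le_exists: "\<exists>B. six_le B n"
  by (rule exI[of _ "\<bar>n $ 1\<bar> + \<bar>n $ 2\<bar> + \<bar>n $ 3\<bar>"]) (auto simp: six_le_def)

text \<open>Orthogonality to \<open>z\<close> forbids three entries of the same strict sign. If
  \<open>n $ 2\<close> is positive, then \<open>n $ 1\<close> or \<open>n $ 3\<close> is at most 0,
  and subtracting it from \<open>n $ 2\<close> gives a form that is at least as large; the negative
  case is symmetric.\<close>

lemma six_le_middle:
  assumes "six_le B n" "n \<bullet> z = 0" "z \<in> nonneg_cone" "z \<noteq> 0"
  shows "\<bar>n $ 2\<bar> \<le> B"
proof -
  have "\<not> (\<forall>j. 0 < n $ j)" using inner_pos_nonneg_eq_0[of n z] assms by auto
  moreover have "\<not> (\<forall>j. 0 < (- n) $ j)" using inner_pos_nonneg_eq_0[of "- n" z] assms by auto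
  ultimately show ?thesis using assms(1) by (auto simp: forall_3 six_le_def)
qed

lemma six_le_pushfwd:
  assumes "six_le B n" "n \<bullet> z = 0" "z \<in> nonneg_cone" "z \<noteq> 0"
  shows "six_le B (pushfwd a n)"
  using six_le_middle[OF assms] assms(1) by (auto simp: six_le_def pushfwd_def)

lemma six_le_corb:
  assumes "x \<in> limit_cone i" "x \<noteq> 0" "n \<bullet> x = 0" "six_le B n"
  shows "six_le B (corb i n k)"
proof (induction k)
  case (Suc k)
  then show ?case
    using six_le_pushfwd[of B "corb i n k" "orb i x k"] assms
    by (simp add: corb_inner_orb mem_limit_cone orb_eq_0_iff)
qed (use assms in simp)

lemma corb_le:
  assumes "x \<in> limit_cone i" "x \<noteq> 0" "n \<bullet> x = 0" "six_le B n"
  shows "\<bar>corb i n k $ j\<bar> \<le> B"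
proof -
  have "\<bar>corb i n k $ 2\<bar> \<le> B"
    using six_le_middle[of B "corb i n k" "orb i x k"] six_le_corb[OF assms] assms
    by (simp add: corb_inner_orb mem_limit_cone orb_eq_0_iff)
  then have "\<forall>j. \<bar>corb i n k $ j\<bar> \<le> B"
    using six_le_corb[OF assms, of k] by (simp add: forall_3 six_le_def)
  then show ?thesis ..
qed

section \<open>Growth of positive row vectors, and constant tails\<close>

definition eventually_const :: "(nat \<Rightarrow> nat) \<Rightarrow> bool" where
  "eventually_const i \<longleftrightarrow> (\<exists>r. (\<forall>k. i (r + k) = 1) \<or> (\<forall>k. i (r + k) \<noteq> 1))"

lemma corb_ge_doubles:
  assumes nc: "\<not> eventually_const i" and "0 < L" and L: "\<And>j. L \<le> corb i n r $ j"
  shows "\<exists>s. \<forall>j. 2 * L \<le> corb i n s $ j"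
proof -
  define c where "c = corb i n"
  have step: "c (Suc k) = pushfwd (i k) (c k)" for k by (simp add: c_def)
  have ge: "\<forall>j. L \<le> c (r + k) $ j" for k
  proof (induction k)
    case (Suc k)
    then show ?case using \<open>0 < L\<close> by (simp add: step pushfwd_def forall_3)
  qed (simp add: c_def L)
  \<comment> \<open>The new middle entry is the sum of the outer two, each at least
    \<open>L\<close>.\<close>
  have mid: "2 * L \<le> c (Suc (r + k)) $ 2" for k
  proof -
    have "2 * L \<le> c (r + k) $ 1 + c (r + k) $ 3" using ge[of k] by (simp add: forall_3)
    then show ?thesis by (simp add: step pushfwd_def)
  qed
  let ?t = "Suc (Suc r)"
  have two: "2 * L \<le> c (?t + k) $ 2" for k using mid[of "Suc k"] by simp
  \<comment> \<open>Symbol 1 copies the middle entry into the third place, the other symbol into the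
    first. The place filled here stays large, being either kept or overwritten by the middle entry;
    the other place is filled when the opposite symbol occurs.\<close>
  have 1: "2 * L \<le> c ?t $ 3 \<or> 2 * L \<le> c ?t $ 1"
    using mid[of 0] by (simp add: step[of "Suc r"] pushfwd_def)
  obtain a where a: "i (?t + a) = 1" using nc unfolding eventually_const_def by blast
  obtain b where b: "i (?t + b) \<noteq> 1" using nc unfolding eventually_const_def by blast
  from 1 show ?thesis
  proof
    assume h: "2 * L \<le> c ?t $ 3"
    have *: "2 * L \<le> c (?t + k) $ 3" for k
    proof (induction k)
      case (Suc k)
      then show ?case using two[of k] by (simp add: step pushfwd_def)
    qed (use h in simp)
    have "2 * L \<le> c (Suc (?t + b)) $ 1" using two[of b] b by (simp add: step pushfwd_def)
    then show ?thesis
      using *[of "Suc b"] two[of "Suc b"] unfolding forall_3 c_def[symmetric] by (metis add_Suc_right)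
  next
    assume h: "2 * L \<le> c ?t $ 1"
    have *: "2 * L \<le> c (?t + k) $ 1" for k
    proof (induction k)
      case (Suc k)
      then show ?case using two[of k] by (simp add: step pushfwd_def)
    qed (use h in simp)
    have "2 * L \<le> c (Suc (?t + a)) $ 3" using two[of a] a by (simp add: step pushfwd_def)
    then show ?thesis
      using *[of "Suc a"] two[of "Suc a"] unfolding forall_3 c_def[symmetric] by (metis add_Suc_right)
  qed
qed

lemma corb_ge_power:
  assumes "\<not> eventually_const i"
  shows "\<exists>s. \<forall>j. 2 ^ m \<le> corb i 1 s $ j"
proof (induction m)
  case 0
  then show ?case by (intro exI[of _ 0]) simp
next
  case (Suc m)
  then show ?case using corb_ge_doubles[OF assms, of "2 ^ m" 1] by force
qed

text \<open>Two steps with symbol 1 subtract \<open>x $ 2 + x $ 3\<close> from the first entry and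
  fix the other two, so nonnegativity of the whole orbit forces this sum to vanish.\<close>

lemma pull_const_one:
  assumes "\<And>k. i k = 1" "x \<in> limit_cone i"
  shows "x $ 2 = 0" "x $ 3 = 0"
proof -
  have orb2: "orb i x (2 * k) = vector [x $ 1 - k * (x $ 2 + x $ 3), x $ 2, x $ 3]" for k
    by (induction k) (simp_all add: assms(1) pull_def vec_eq_iff forall_3 algebra_simps)
  have pos: "orb i x k \<in> nonneg_cone" for k using assms(2) by (simp add: mem_limit_cone)
  have "x $ 2 + x $ 3 \<le> 0"
  proof (rule ccontr)
    assume "\<not> ?thesis"
    then obtain k :: nat where "x $ 1 < k * (x $ 2 + x $ 3)"
      using reals_Archimedean3[of "x $ 2 + x $ 3"] by force
    then show False using pos[of "2 * k"] by (simp add: orb2 mem_nonneg_cone)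
  qed
  then show "x $ 2 = 0" "x $ 3 = 0" using pos[of 0] by (auto simp: mem_nonneg_cone)
qed

lemma pull_const_two:
  assumes "\<And>k. i k \<noteq> 1" "x \<in> limit_cone i"
  shows "x $ 1 = 0" "x $ 2 = 0"
proof -
  have orb2: "orb i x (2 * k) = vector [x $ 1, x $ 2, x $ 3 - k * (x $ 1 + x $ 2)]" for k
    using assms(1) by (induction k) (simp_all add: pull_def vec_eq_iff forall_3 algebra_simps)
  have pos: "orb i x k \<in> nonneg_cone" for k using assms(2) by (simp add: mem_limit_cone)
  have "x $ 1 + x $ 2 \<le> 0"
  proof (rule ccontr)
    assume "\<not> ?thesis"
    then obtain k :: nat where "x $ 3 < k * (x $ 1 + x $ 2)"
      using reals_Archimedean3[of "x $ 1 + x $ 2"] by force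
    then show False using pos[of "2 * k"] by (simp add: orb2 mem_nonneg_cone)
  qed
  then show "x $ 1 = 0" "x $ 2 = 0" using pos[of 0] by (auto simp: mem_nonneg_cone)
qed

lemma limit_cone_orb:
  assumes "x \<in> limit_cone i"
  shows "orb i x r \<in> limit_cone (\<lambda>n. i (r + n))"
  using assms by (simp add: mem_limit_cone orb_add[symmetric])

text \<open>This is the core of uniqueness: no linear form separates the line of \<open>x\<close>
  from another point \<open>y\<close> of the limit cone.\<close>

lemma limit_cone_orthogonal:
  assumes x: "x \<in> limit_cone i" "x \<noteq> 0" and n: "n \<bullet> x = 0" and y: "y \<in> limit_cone i"
  shows "n \<bullet> y = 0"
proof (cases "eventually_const i")
  case True
  then obtain r where "(\<forall>k. i (r + k) = 1) \<or> (\<forall>k. i (r + k) \<noteq> 1)"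
    by (auto simp: eventually_const_def)
  then show ?thesis
  proof
    assume h: "\<forall>k. i (r + k) = 1"
    \<comment> \<open>A constant tail confines the whole limit cone, seen at time \<open>r\<close>,
      to one coordinate axis.\<close>
    have 2: "orb i z r $ 2 = 0" "orb i z r $ 3 = 0" if "z \<in> limit_cone i" for z
      using pull_const_one[of "\<lambda>n. i (r + n)" "orb i z r"] h limit_cone_orb[OF that, of r] by auto
    have "orb i x r $ 1 \<noteq> 0" using 2[OF x(1)] x(2) orb_eq_0_iff[of i x r]
      by (auto simp: vec_eq_iff forall_3)
    then have "corb i n r $ 1 = 0"
      using corb_inner_orb[of i n r x] n 2[OF x(1)] by (simp add: inner_3)
    then show ?thesis
      using corb_inner_orb[of i n r y] 2[OF y] by (simp add: inner_3)
  next
    assume h: "\<forall>k. i (r + k) \<noteq> 1"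
    have 2: "orb i z r $ 1 = 0" "orb i z r $ 2 = 0" if "z \<in> limit_cone i" for z
      using pull_const_two[of "\<lambda>n. i (r + n)" "orb i z r"] h limit_cone_orb[OF that, of r] by auto
    have "orb i x r $ 3 \<noteq> 0" using 2[OF x(1)] x(2) orb_eq_0_iff[of i x r]
      by (auto simp: vec_eq_iff forall_3)
    then have "corb i n r $ 3 = 0"
      using corb_inner_orb[of i n r x] n 2[OF x(1)] by (simp add: inner_3)
    then show ?thesis
      using corb_inner_orb[of i n r y] 2[OF y] by (simp add: inner_3)
  qed
next
  case False
  obtain B where B: "six_le B n" using six_le_exists by blast
  then have "0 \<le> B" by (auto simp: six_le_def)
  \<comment> \<open>With \<open>z\<close> the orbit point of \<open>y\<close> at time
    \<open>s\<close>, pairing with \<open>n\<close> is at most \<open>B\<close> times the entry sum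
    of \<open>z\<close>. Pairing with the row orbit of the all-one vector is at least
    \<open>2 ^ m\<close> times that sum, yet always equals \<open>l1_norm y\<close>.\<close>
  have bound: "2 ^ m * \<bar>n \<bullet> y\<bar> \<le> B * l1_norm y" for m
  proof -
    obtain s where s: "\<forall>j. 2 ^ m \<le> corb i 1 s $ j" using corb_ge_power[OF False] by blast
    let ?z = "orb i y s" and ?N = "corb i n s"
    have z: "0 \<le> ?z $ j" for j using y by (simp add: mem_limit_cone nonneg_cone_def)
    have "\<bar>n \<bullet> y\<bar> = \<bar>\<Sum>j\<in>UNIV. ?N $ j * ?z $ j\<bar>"
      using corb_inner_orb[of i n s y] by (simp add: inner_vec_def)
    also have "\<dots> \<le> (\<Sum>j\<in>UNIV. B * ?z $ j)"
      using corb_le[OF x n B, of s] z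
      by (intro order_trans[OF sum_abs] sum_mono) (simp add: abs_mult mult_right_mono)
    finally have "2 ^ m * \<bar>n \<bullet> y\<bar> \<le> 2 ^ m * (\<Sum>j\<in>UNIV. B * ?z $ j)" by simp
    also have "\<dots> = B * (\<Sum>j\<in>UNIV. 2 ^ m * ?z $ j)" by (simp add: sum_distrib_left mult_ac)
    also have "\<dots> \<le> B * (\<Sum>j\<in>UNIV. corb i 1 s $ j * ?z $ j)"
      using s z \<open>0 \<le> B\<close> by (intro mult_left_mono sum_mono mult_right_mono) auto
    also have "(\<Sum>j\<in>UNIV. corb i 1 s $ j * ?z $ j) = 1 \<bullet> y"
      using corb_inner_orb[of i 1 s y] by (simp add: inner_vec_def)
    also have "1 \<bullet> y = l1_norm y"
      using y mem_limit_cone[of y i] by (auto simp: inner_3 l1_norm_3 mem_nonneg_cone dest: spec[of _ 0])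
    finally show ?thesis .
  qed
  show ?thesis
  proof (rule ccontr)
    assume "n \<bullet> y \<noteq> 0"
    then obtain m where "B * l1_norm y / \<bar>n \<bullet> y\<bar> < 2 ^ m"
      using real_arch_pow[of 2] by auto
    with bound[of m] \<open>n \<bullet> y \<noteq> 0\<close> show False by (simp add: divide_less_eq)
  qed
qed

lemma limit_cone_unique:
  assumes x: "x \<in> limit_cone i" "x \<in> simplex3" and y: "y \<in> limit_cone i" "y \<in> simplex3"
  shows "x = y"
proof -
  have "x \<noteq> 0" using x(2) by (auto simp: mem_simplex3)
  note orth = limit_cone_orthogonal[OF x(1) this _ y(1)]
  \<comment> \<open>The three test vectors are orthogonal to \<open>x\<close>; they yield the
    vanishing of all 2 by 2 minors of the pair \<open>x\<close>, \<open>y\<close>.\<close>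
  have a: "x $ 2 * y $ 1 = x $ 1 * y $ 2"
    using orth[of "vector [x $ 2, - x $ 1, 0]"] by (simp add: inner_3)
  have b: "x $ 3 * y $ 1 = x $ 1 * y $ 3"
    using orth[of "vector [x $ 3, 0, - x $ 1]"] by (simp add: inner_3)
  have c: "x $ 3 * y $ 2 = x $ 2 * y $ 3"
    using orth[of "vector [0, x $ 3, - x $ 2]"] by (simp add: inner_3)
  have s: "x $ 1 + x $ 2 + x $ 3 = 1" "y $ 1 + y $ 2 + y $ 3 = 1"
    using x y by (auto simp: mem_simplex3)
  have "x $ j * (y $ 1 + y $ 2 + y $ 3) = y $ j * (x $ 1 + x $ 2 + x $ 3)" for j
    using exhaust_3[of j] a b c by (auto simp: algebra_simps)
  then show ?thesis by (simp add: s vec_eq_iff)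
qed

section \<open>Existence and approximation of the limit point by compactness\<close>

primrec approx :: "nat \<Rightarrow> (nat \<Rightarrow> nat) \<Rightarrow> real^3" where
  "approx 0 i = 1"
| "approx (Suc k) i = C_mat (i 0) *v approx k (shift_map i)"

text \<open>The point \<open>approx k i\<close> is the pullback of the all-one vector along the
  first \<open>k\<close> symbols. It serves both to show that cylinders are nonempty and to write
  \<open>pi_map\<close> as a limit.\<close>

lemma orb_approx: "orb i (approx k i) k = 1"
  by (induction k arbitrary: i) (simp_all add: orb_Suc_shift del: orb.simps(2))

definition approx_simplex :: "nat \<Rightarrow> (nat \<Rightarrow> nat) \<Rightarrow> real^3" where
  "approx_simplex k i = (1 / l1_norm (approx k i)) *\<^sub>R approx k i"

text \<open>Testing time \<open>k\<close> alone suffices, since nonnegativity then holds at all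
  earlier times; the sets are therefore nested.\<close>

definition cylinder :: "(nat \<Rightarrow> nat) \<Rightarrow> nat \<Rightarrow> (real^3) set" where
  "cylinder i k = {x \<in> simplex3. orb i x k \<in> nonneg_cone}"

lemma normalize_simplex3:
  assumes "x \<in> nonneg_cone" "x \<noteq> 0"
  shows "0 < l1_norm x" "(1 / l1_norm x) *\<^sub>R x \<in> simplex3"
proof -
  show p: "0 < l1_norm x"
    using assms by (auto simp: l1_norm_3 mem_nonneg_cone vec_eq_iff forall_3)
  show "(1 / l1_norm x) *\<^sub>R x \<in> simplex3"
    using p assms(1) by (simp add: mem_simplex3 mem_nonneg_cone l1_norm_3 add_divide_distrib[symmetric])
qed

lemma approx_simplex_in_cylinder: "approx_simplex k i \<in> cylinder i k"
proof -
  have o: "orb i (approx k i) k \<in> nonneg_cone" by (simp add: orb_approx mem_nonneg_cone)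
  have c: "approx k i \<in> nonneg_cone" using orb_nonneg_cone_mono[OF o, of 0] by simp
  moreover have "approx k i \<noteq> 0" using orb_approx[of i k] orb_eq_0_iff[of i _ k]
    by (metis one_neq_zero)
  ultimately have "approx_simplex k i \<in> simplex3" "0 < l1_norm (approx k i)"
    using normalize_simplex3 by (auto simp: approx_simplex_def)
  then show ?thesis
    by (simp add: cylinder_def approx_simplex_def orb_scaleR orb_approx mem_nonneg_cone)
qed

lemma closed_nonneg_cone: "closed nonneg_cone"
proof -
  have "nonneg_cone = (\<Inter>j. {x. 0 \<le> x $ j})" by (auto simp: nonneg_cone_def)
  also have "closed \<dots>" by (intro closed_INT ballI closed_Collect_le continuous_intros)
  finally show ?thesis .
qed

lemma continuous_l1_norm: "continuous_on UNIV l1_norm"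
  unfolding l1_norm_def by (intro continuous_intros)

lemma compact_simplex3: "compact simplex3"
proof -
  have "simplex3 = nonneg_cone \<inter> {x. l1_norm x = 1}" by (auto simp: simplex3_def)
  moreover have "closed {x. l1_norm x = 1}"
    by (intro closed_Collect_eq continuous_l1_norm continuous_intros)
  ultimately have "closed simplex3" using closed_nonneg_cone by (metis closed_Int)
  moreover have "bounded simplex3"
    by (rule boundedI[of _ 1]) (metis (mono_tags, lifting) simplex3_def mem_Collect_eq l1_norm_def norm_le_l1_cart)
  ultimately show ?thesis by (simp add: compact_eq_bounded_closed)
qed

lemma compact_cylinder: "compact (cylinder i k)"
proof -
  have "cylinder i k = simplex3 \<inter> (\<lambda>x. orb i x k) -` nonneg_cone" by (auto simp: cylinder_def)
  moreover have "closed ((\<lambda>x. orb i x k) -` nonneg_cone)"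
    by (intro closed_vimage closed_nonneg_cone continuous_orb)
  ultimately show ?thesis by (simp add: compact_Int_closed compact_simplex3)
qed

lemma cylinder_antimono: "k \<le> l \<Longrightarrow> cylinder i l \<subseteq> cylinder i k"
  by (auto simp: cylinder_def intro: orb_nonneg_cone_mono)

lemma Inter_cylinder: "(\<Inter>k. cylinder i k) = limit_cone i \<inter> simplex3"
  by (auto simp: cylinder_def mem_limit_cone)

lemma pi_map:
  shows pi_map_limit_cone: "pi_map i \<in> limit_cone i" and pi_map_simplex3: "pi_map i \<in> simplex3"
proof -
  have "(\<Inter>k. cylinder i k) \<noteq> {}"
    using approx_simplex_in_cylinder
    by (intro compact_nest compact_cylinder cylinder_antimono) auto
  then obtain x where "x \<in> limit_cone i \<and> x \<in> simplex3" unfolding Inter_cylinder by blast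
  then have "pi_map i \<in> limit_cone i \<and> pi_map i \<in> simplex3"
    unfolding pi_map_def by (rule theI) (use limit_cone_unique \<open>x \<in> limit_cone i \<and> x \<in> simplex3\<close> in blast)
  then show "pi_map i \<in> limit_cone i" "pi_map i \<in> simplex3" by auto
qed

lemma pi_map_eqI: "x \<in> limit_cone i \<Longrightarrow> x \<in> simplex3 \<Longrightarrow> pi_map i = x"
  using limit_cone_unique pi_map_limit_cone pi_map_simplex3 by blast

lemma approx_simplex_tendsto: "(\<lambda>k. approx_simplex k i) \<longlonglongrightarrow> pi_map i"
proof (rule topological_tendstoI)
  fix U assume U: "open U" "pi_map i \<in> U"
  \<comment> \<open>Otherwise the nested compact sets \<open>cylinder i k - U\<close> would share a
    point, which uniqueness identifies with \<open>pi_map i\<close>, a point of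
    \<open>U\<close>.\<close>
  have "\<exists>k. cylinder i k - U = {}"
  proof (rule ccontr)
    assume "\<nexists>k. cylinder i k - U = {}"
    then have "(\<Inter>k. cylinder i k - U) \<noteq> {}"
      by (intro compact_nest compact_diff compact_cylinder U Diff_mono cylinder_antimono) auto
    then obtain x where "x \<in> (\<Inter>k. cylinder i k)" "x \<notin> U" by auto
    then show False using pi_map_eqI[of x i] U(2) unfolding Inter_cylinder by auto
  qed
  then obtain k where "cylinder i k \<subseteq> U" by auto
  then have "approx_simplex l i \<in> U" if "k \<le> l" for l
    using that cylinder_antimono[of k l i] approx_simplex_in_cylinder[of l i] by auto
  then show "\<forall>\<^sub>F k in sequentially. approx_simplex k i \<in> U"
    by (auto simp: eventually_sequentially)
qed

section \<open>Primitive sequences\<close>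

text \<open>Sequences that are not eventually a concatenation of the blocks 11 and 22.\<close>

definition parity_defects :: "(nat \<Rightarrow> nat) \<Rightarrow> bool" where
  "parity_defects i \<longleftrightarrow> (\<forall>r. \<exists>k. (i (r + 2 * k) = 1) \<noteq> (i (Suc (r + 2 * k)) = 1))"

lemma parity_defects_not_const: "parity_defects i \<Longrightarrow> \<not> eventually_const i"
  unfolding parity_defects_def eventually_const_def by (metis add.assoc add_Suc_right)

lemma parity_defects_shift: "parity_defects i \<Longrightarrow> parity_defects (\<lambda>n. i (r + n))"
  unfolding parity_defects_def by (metis add.assoc add_Suc_right)

lemma corb_pos_add:
  assumes "\<forall>j. 0 < corb i n s $ j"
  shows "\<forall>j. 0 < corb i n (s + k) $ j"
  using assms by (induction k) (simp_all add: pushfwd_def forall_3)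

text \<open>A positive middle entry survives every block of two symbols, and a block of two
  different symbols makes an adjacent entry positive as well. Two adjacent positive entries persist
  until a suitable symbol fills the third.\<close>

lemma corb_eventually_pos:
  assumes pd: "parity_defects i" and n: "n \<in> nonneg_cone" "n \<noteq> 0"
  shows "\<exists>s. \<forall>j. 0 < corb i n s $ j"
proof -
  define c where "c = corb i n"
  have step: "c (Suc k) = pushfwd (i k) (c k)" for k by (simp add: c_def)
  have nn: "0 \<le> c k $ 1 \<and> 0 \<le> c k $ 2 \<and> 0 \<le> c k $ 3" for k
  proof (induction k)
    case 0
    then show ?case using n by (simp add: c_def mem_nonneg_cone)
  next
    case (Suc k)
    then show ?case by (simp add: step pushfwd_def)
  qed
  have e12: "\<exists>s. \<forall>j. 0 < c s $ j" if h: "0 < c r $ 1" "0 < c r $ 2" for r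
  proof -
    have *: "0 < c (r + k) $ 1 \<and> 0 < c (r + k) $ 2" for k
    proof (induction k)
      case (Suc k)
      then show ?case using nn[of "r + k"] by (simp add: step pushfwd_def)
    qed (use h in simp)
    obtain a where "i (r + a) = 1"
      using parity_defects_not_const[OF pd] unfolding eventually_const_def by blast
    then have "\<forall>j. 0 < c (Suc (r + a)) $ j"
      using *[of a] nn[of "r + a"] by (simp add: step pushfwd_def forall_3)
    then show ?thesis ..
  qed
  have e23: "\<exists>s. \<forall>j. 0 < c s $ j" if h: "0 < c r $ 2" "0 < c r $ 3" for r
  proof -
    have *: "0 < c (r + k) $ 2 \<and> 0 < c (r + k) $ 3" for k
    proof (induction k)
      case (Suc k)
      then show ?case using nn[of "r + k"] by (simp add: step pushfwd_def)
    qed (use h in simp)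
    obtain a where "i (r + a) \<noteq> 1"
      using parity_defects_not_const[OF pd] unfolding eventually_const_def by blast
    then have "\<forall>j. 0 < c (Suc (r + a)) $ j"
      using *[of a] nn[of "r + a"] by (simp add: step pushfwd_def forall_3)
    then show ?thesis ..
  qed
  have e2: "\<exists>s. \<forall>j. 0 < c s $ j" if h: "0 < c r $ 2" for r
  proof -
    have *: "0 < c (r + 2 * k) $ 2" for k
    proof (induction k)
      case (Suc k)
      then show ?case using nn[of "r + 2 * k"] by (auto simp: step pushfwd_def)
    qed (use h in simp)
    obtain k where k: "(i (r + 2 * k) = 1) \<noteq> (i (Suc (r + 2 * k)) = 1)"
      using pd unfolding parity_defects_def by blast
    let ?s = "r + 2 * k"
    show ?thesis
    proof (cases "i ?s = 1")
      case True
      then show ?thesis using e23[of "Suc (Suc ?s)"] k *[of k] nn[of ?s]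
        by (simp add: step pushfwd_def)
    next
      case False
      then show ?thesis using e12[of "Suc (Suc ?s)"] k *[of k] nn[of ?s]
        by (simp add: step pushfwd_def)
    qed
  qed
  \<comment> \<open>If the middle entry vanishes at the start, the sum of the outer ones is the
    middle entry one step later.\<close>
  have "0 < c 0 $ 2 \<or> 0 < c 0 $ 1 + c 0 $ 3"
    using n nn[of 0] by (auto simp: c_def vec_eq_iff forall_3)
  then have "0 < c 0 $ 2 \<or> 0 < c 1 $ 2" by (simp add: step pushfwd_def)
  then show ?thesis using e2 unfolding c_def by blast
qed

lemma primitive_seqs_eq: "primitive_seqs = {i \<in> seqs12. parity_defects i}"
proof (intro equalityI subsetI)
  fix i assume "i \<in> primitive_seqs"
  then have i: "i \<in> seqs12" and prim: "primitive_seq (\<lambda>n. C_mat (i n))"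
    by (auto simp: primitive_seqs_def)
  have "parity_defects i"
  proof (rule ccontr)
    assume "\<not> parity_defects i"
    then obtain r where r: "\<And>k. (i (r + 2 * k) = 1) = (i (Suc (r + 2 * k)) = 1)"
      unfolding parity_defects_def by blast
    obtain s where s: "s > r" "\<forall>l j. 0 < mat_prod (\<lambda>n. C_mat (i n)) r s $ l $ j"
      using prim unfolding primitive_seq_def by blast
    obtain t where t: "s = r + t" using s(1) by (metis less_imp_add_positive)
    let ?c = "corb (\<lambda>n. i (r + n)) (axis 2 1)"
    have pos: "0 < ?c t $ j" for j
      using s(2) unfolding t mat_prod_row by blast
    \<comment> \<open>Both blocks 11 and 22 fix the second unit row vector, and halfway through a
      block its middle entry is 0. The second row of the product is thus never positive.\<close>
    have even: "?c (2 * k) = axis 2 1" for k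
    proof (induction k)
      case (Suc k)
      then show ?case using r[of k] by (simp add: pushfwd_def vec_eq_iff forall_3 axis_def)
    qed simp
    have "?c (Suc (2 * k)) $ 2 = 0" for k
      using even[of k] by (simp add: pushfwd_def axis_def)
    moreover have "?c (2 * k) $ 1 = 0" for k
      using even[of k] by (simp add: axis_def)
    ultimately show False using pos by (metis evenE oddE less_irrefl Suc_eq_plus1)
  qed
  with i show "i \<in> {i \<in> seqs12. parity_defects i}" by simp
next
  fix i assume "i \<in> {i \<in> seqs12. parity_defects i}"
  then have i: "i \<in> seqs12" "parity_defects i" by auto
  have "0 \<le> C_mat a $ l $ j" for a l j
  proof -
    have "\<forall>l j. 0 \<le> C_mat a $ l $ j" by (simp add: C_mat_def C1_def C2_def forall_3)
    then show ?thesis by blast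
  qed
  moreover have "\<exists>s>r. \<forall>l j. 0 < mat_prod (\<lambda>n. C_mat (i n)) r s $ l $ j" for r
  proof -
    let ?c = "\<lambda>l. corb (\<lambda>n. i (r + n)) (axis l 1)"
    have "\<exists>s. \<forall>j. 0 < ?c l s $ j" for l
      by (intro corb_eventually_pos parity_defects_shift i)
        (auto simp: nonneg_cone_def axis_def vec_eq_iff)
    then obtain s where s: "\<And>l. \<forall>j. 0 < ?c l (s l) $ j" by metis
    \<comment> \<open>Positivity persists, so a time beyond all three \<open>s l\<close> works for
      all rows at once; \<open>Suc\<close> makes the product nonempty.\<close>
    define t where "t = Suc (\<Sum>l\<in>UNIV. s l)"
    have "s l \<le> t" for l using member_le_sum[of l UNIV s] by (simp add: t_def)
    then have "\<forall>j. 0 < ?c l t $ j" for l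
      using corb_pos_add[OF s, of l "t - s l"] by simp
    then have "\<forall>l j. 0 < mat_prod (\<lambda>n. C_mat (i n)) r (r + t) $ l $ j"
      by (simp add: mat_prod_row)
    moreover have "r < r + t" by (simp add: t_def)
    ultimately show ?thesis by blast
  qed
  ultimately show "i \<in> primitive_seqs" using i(1) by (auto simp: primitive_seqs_def primitive_seq_def)
qed

text \<open>The entry \<open>j\<close> is the pairing with a unit row vector. Later this becomes the
  pairing of a positive row vector with a nonzero nonnegative vector.\<close>

lemma orb_pos:
  assumes "parity_defects i" "x \<in> limit_cone i" "x \<noteq> 0"
  shows "0 < orb i x k $ j"
proof -
  let ?i = "\<lambda>n. i (k + n)" and ?x = "orb i x k"
  have "axis j 1 \<in> nonneg_cone" "axis j 1 \<noteq> (0 :: real^3)"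
    by (auto simp: nonneg_cone_def axis_def vec_eq_iff)
  then obtain s where s: "\<forall>l. 0 < corb ?i (axis j 1) s $ l"
    using corb_eventually_pos[OF parity_defects_shift[OF assms(1)]] by blast
  have "orb ?i ?x s \<in> nonneg_cone" "orb ?i ?x s \<noteq> 0"
    using assms by (simp_all add: orb_add[symmetric] mem_limit_cone orb_eq_0_iff)
  then have "corb ?i (axis j 1) s \<bullet> orb ?i ?x s \<noteq> 0"
    using inner_pos_nonneg_eq_0[of "corb ?i (axis j 1) s" "orb ?i ?x s"] s by blast
  then have "?x $ j \<noteq> 0" by (simp add: corb_inner_orb inner_axis' inner_commute)
  moreover have "0 \<le> ?x $ j" using assms(2) by (simp add: mem_limit_cone nonneg_cone_def)
  ultimately show ?thesis by simp
qed

section \<open>Rational independence\<close>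

definition six_lt :: "real \<Rightarrow> real^3 \<Rightarrow> bool" where
  "six_lt B n \<longleftrightarrow> \<bar>n $ 1\<bar> < B \<and> \<bar>n $ 3\<bar> < B \<and> \<bar>n $ 1 - n $ 2\<bar> < B \<and> \<bar>n $ 2 - n $ 3\<bar> < B \<and>
     \<bar>n $ 1 - n $ 3\<bar> < B \<and> \<bar>n $ 2 - n $ 1 - n $ 3\<bar> < B"

text \<open>As \<open>z\<close> is positive, \<open>n\<close> has entries of both strict signs,
  which makes the comparison in \<open>six_le_middle\<close> strict.\<close>

lemma six_le_middle_strict:
  assumes "six_le B n" "n \<bullet> z = 0" "n \<noteq> 0" "\<And>j. 0 < z $ j"
  shows "\<bar>n $ 2\<bar> < B"
proof -
  have z: "z \<bullet> n = 0" using assms(2) by (simp add: inner_commute)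
  have "n \<notin> nonneg_cone" using inner_pos_nonneg_eq_0[OF assms(4) _ z] assms(3) by blast
  moreover have "- n \<notin> nonneg_cone"
    using inner_pos_nonneg_eq_0[OF assms(4), of "- n"] z assms(3) by auto
  ultimately show ?thesis using assms(1) by (auto simp: mem_nonneg_cone six_le_def)
qed

lemma six_le_decreases:
  assumes pd: "parity_defects i" and x: "x \<in> limit_cone i" "x \<noteq> 0"
    and n: "n \<bullet> x = 0" "n \<noteq> 0" "six_le B n"
  shows "\<exists>k. six_lt B (corb i n k)"
proof -
  define c where "c = corb i n"
  have step: "c (Suc k) = pushfwd (i k) (c k)" for k by (simp add: c_def)
  have 2: "\<bar>c k $ 2\<bar> < B" for k
    unfolding c_def
    by (rule six_le_middle_strict[OF six_le_corb[OF x n(1,3)], of _ "orb i x k"])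
      (use n orb_pos[OF pd x] in \<open>simp_all add: corb_inner_orb corb_eq_0_iff\<close>)
  obtain a b where ab: "i a \<noteq> 1" "i b = 1"
    using parity_defects_not_const[OF pd] unfolding eventually_const_def by (metis add_0)
  \<comment> \<open>The first entry takes over the strictly bounded middle entry at time
    \<open>a\<close>, and afterwards is kept or replaced by a middle entry. The third entry behaves
    likewise after time \<open>b\<close>.\<close>
  have 1: "\<bar>c (Suc a + k) $ 1\<bar> < B" for k
  proof (induction k)
    case (Suc k)
    then show ?case using 2[of "Suc a + k"]
      unfolding add_Suc_right step[of "Suc a + k"] pushfwd_def by simp
  qed (use ab 2[of a] in \<open>simp add: step pushfwd_def\<close>)
  have 3: "\<bar>c (Suc b + k) $ 3\<bar> < B" for k
  proof (induction k)
    case (Suc k)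
    then show ?case using 2[of "Suc b + k"]
      unfolding add_Suc_right step[of "Suc b + k"] pushfwd_def by simp
  qed (use ab 2[of b] in \<open>simp add: step pushfwd_def\<close>)
  define m where "m = Suc (a + b)"
  have 1: "\<bar>c k $ 1\<bar> < B" and 3: "\<bar>c k $ 3\<bar> < B" if "m \<le> k" for k
    using 1[of "k - Suc a"] 3[of "k - Suc b"] that by (auto simp: m_def)
  define d p q where "d = (\<lambda>k. \<bar>c k $ 2 - c k $ 1 - c k $ 3\<bar>)"
    and "p = (\<lambda>k. \<bar>c k $ 1 - c k $ 2\<bar>)" and "q = (\<lambda>k. \<bar>c k $ 2 - c k $ 3\<bar>)"
  have d: "d (Suc k) = (if i k = 1 then q k else p k)" for k
    by (auto simp: d_def p_def q_def step pushfwd_def)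
  have p: "p (Suc k) = (if i k = 1 then \<bar>c k $ 3\<bar> else d k)" for k
    by (auto simp: d_def p_def q_def step pushfwd_def)
  have q: "q (Suc k) = (if i k = 1 then d k else \<bar>c k $ 1\<bar>)" for k
    by (auto simp: d_def p_def q_def step pushfwd_def)
  \<comment> \<open>Since \<open>d\<close> at time \<open>k + 2\<close> is \<open>p\<close> or
    \<open>q\<close> at time \<open>k + 1\<close>, strictness of \<open>d\<close> passes on from
    \<open>k\<close> to \<open>k + 2\<close>.\<close>
  have pq: "p (Suc k) < B \<and> q (Suc k) < B" if "d k < B" "m \<le> k" for k
    using that 1 3 by (simp add: p q)
  \<comment> \<open>A block of two different symbols starts the strictness: there \<open>d\<close>
    becomes the absolute value of an outer entry two steps earlier.\<close>
  have track: "\<exists>k. \<forall>l. d (r + 2 * (k + l)) < B" if "m \<le> r" for r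
  proof -
    obtain k where k: "(i (r + 2 * k) = 1) \<noteq> (i (Suc (r + 2 * k)) = 1)"
      using pd unfolding parity_defects_def by blast
    have "d (r + 2 * (Suc k + l)) < B" for l
    proof (induction l)
      case 0
      then show ?case using k 1[of "r + 2 * k"] 3[of "r + 2 * k"] that by (auto simp: d p q)
    next
      case (Suc l)
      then show ?case using pq[OF Suc] that by (simp add: d)
    qed
    then show ?thesis by blast
  qed
  \<comment> \<open>Strictness of \<open>d\<close> propagates only within a parity class, so both
    classes are started and then merged at a common \<open>t\<close>.\<close>
  obtain u where u: "\<And>l. d (m + 2 * (u + l)) < B" using track[of m] by blast
  obtain v where v: "\<And>l. d (Suc m + 2 * (v + l)) < B" using track[of "Suc m"] by auto
  define t where "t = m + 2 * (u + v)"
  have t: "d t < B" "d (Suc t) < B" "d (Suc (Suc t)) < B"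
    using u[of v] v[of u] u[of "Suc v"] by (simp_all add: t_def algebra_simps)
  have "p (Suc t) < B" "q (Suc t) < B" "p (Suc (Suc t)) < B" "q (Suc (Suc t)) < B"
    using pq[of t] pq[of "Suc t"] t by (simp_all add: t_def)
  moreover from this have "\<bar>c (Suc (Suc t)) $ 1 - c (Suc (Suc t)) $ 3\<bar> < B"
    by (simp add: step[of "Suc t"] pushfwd_def p_def q_def)
  moreover have "\<bar>c (Suc (Suc t)) $ 1\<bar> < B" "\<bar>c (Suc (Suc t)) $ 3\<bar> < B"
    by (intro 1 3; simp add: t_def)+
  ultimately have "six_lt B (c (Suc (Suc t)))"
    using t by (simp add: six_lt_def p_def q_def d_def)
  then show ?thesis unfolding c_def by blast
qed

lemma corb_Ints:
  assumes "\<forall>j. n $ j \<in> \<int>"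
  shows "\<forall>j. corb i n k $ j \<in> \<int>"
  using assms by (induction k) (simp_all add: pushfwd_def forall_3)

lemma Ints_abs_less_Suc:
  assumes "a \<in> \<int>" "\<bar>a\<bar> < real (Suc B)"
  shows "\<bar>a\<bar> \<le> real B"
proof -
  obtain z where z: "a = of_int z" using assms(1) by (auto elim: Ints_cases)
  then have "\<bar>z\<bar> < int (Suc B)" using assms(2) by linarith
  then show ?thesis using z by linarith
qed

text \<open>Infinite descent: for an integral vector the strict drop of the six forms lowers a
  natural bound by 1, and a strict bound by 0 is absurd.\<close>

lemma integral_relation_trivial:
  assumes "parity_defects i" "x \<in> limit_cone i" "x \<noteq> 0" "n \<bullet> x = 0" "\<forall>j. n $ j \<in> \<int>"
  shows "n = 0"
proof (rule ccontr)
  have "False" if "parity_defects i" "x \<in> limit_cone i" "x \<noteq> 0" "n \<bullet> x = 0" "\<forall>j. n $ j \<in> \<int>"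
    "n \<noteq> 0" "six_le (real B) n" for B i x n
    using that
  proof (induction B arbitrary: i x n)
    case 0
    then show False using six_le_decreases[of i x n 0]
      by (auto simp: six_lt_def)
  next
    case (Suc B)
    obtain k where k: "six_lt (real (Suc B)) (corb i n k)"
      using six_le_decreases Suc.prems by blast
    have ints: "\<forall>j. corb i n k $ j \<in> \<int>" by (rule corb_Ints) (fact Suc.prems)
    have "six_le (real B) (corb i n k)"
      using k ints unfolding six_lt_def six_le_def
      by (intro conjI Ints_abs_less_Suc Ints_diff) auto
    then show False
      using Suc.IH[of "\<lambda>n. i (k + n)" "orb i x k" "corb i n k"] Suc.prems ints
      by (simp add: parity_defects_shift limit_cone_orb orb_eq_0_iff corb_eq_0_iff corb_inner_orb)
  qed
  moreover obtain B where "six_le B n" using six_le_exists by blast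
  then have "six_le (real (nat \<lceil>B\<rceil>)) n"
    unfolding six_le_def by (meson order_trans real_nat_ceiling_ge)
  moreover assume "n \<noteq> 0"
  ultimately show False using assms by blast
qed

section \<open>Rational independence and parity defects\<close>

definition rat_indep :: "real^3 \<Rightarrow> bool" where
  "rat_indep x \<longleftrightarrow> (\<forall>a b c :: rat. of_rat a * x $ 1 + of_rat b * x $ 2 + of_rat c * x $ 3 = 0
     \<longrightarrow> a = 0 \<and> b = 0 \<and> c = 0)"

text \<open>Separate quantifiers over three rationals suit the coordinate computations and make
  measurability a matter of countable quantifiers.\<close>

lemma rat_indep_simplex_eq: "rat_indep_simplex = {x \<in> simplex3. rat_indep x}"
proof -
  have "(\<forall>q :: 3 \<Rightarrow> rat. (\<Sum>i\<in>UNIV. of_rat (q i) * x $ i) = 0 \<longrightarrow> (\<forall>i. q i = 0)) \<longleftrightarrow> rat_indep x"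
    (is "?l \<longleftrightarrow> _") for x
  proof
    assume l: ?l
    show "rat_indep x"
      unfolding rat_indep_def
    proof (intro allI impI)
      fix a b c :: rat
      assume "of_rat a * x $ 1 + of_rat b * x $ 2 + of_rat c * x $ 3 = 0"
      then have "(if j = 1 then a else if j = 2 then b else c) = 0" for j :: 3
        using l[rule_format, of "\<lambda>j. if j = 1 then a else if j = 2 then b else c"]
        by (simp add: sum_3)
      from this[of 1] this[of 2] this[of 3] show "a = 0 \<and> b = 0 \<and> c = 0" by simp
    qed
  qed (simp add: rat_indep_def sum_3 forall_3)
  then show ?thesis by (auto simp: rat_indep_simplex_def)
qed

lemma rat_indep_pull:
  assumes "rat_indep x"
  shows "rat_indep (pull s x)"
  unfolding rat_indep_def
proof (intro allI impI)
  fix a b c :: rat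
  assume h: "of_rat a * pull s x $ 1 + of_rat b * pull s x $ 2 + of_rat c * pull s x $ 3 = 0"
  show "a = 0 \<and> b = 0 \<and> c = 0"
  proof (cases "s = 1")
    case True
    then have "of_rat a * x $ 1 + of_rat c * x $ 2 + of_rat (b - a) * x $ 3 = 0"
      using h by (simp add: pull_def of_rat_diff algebra_simps)
    then show ?thesis using assms unfolding rat_indep_def by force
  next
    case False
    then have "of_rat (b - c) * x $ 1 + of_rat a * x $ 2 + of_rat c * x $ 3 = 0"
      using h by (simp add: pull_def of_rat_diff algebra_simps)
    then show ?thesis using assms unfolding rat_indep_def by force
  qed
qed

lemma rat_indep_orb: "rat_indep x \<Longrightarrow> rat_indep (orb i x k)"
  by (induction k) (simp_all add: rat_indep_pull)

lemma rat_indep_limit_cone: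
  assumes "parity_defects i" "x \<in> limit_cone i" "x \<noteq> 0"
  shows "rat_indep x"
  unfolding rat_indep_def
proof (intro allI impI)
  fix a b c :: rat
  assume h: "of_rat a * x $ 1 + of_rat b * x $ 2 + of_rat c * x $ 3 = 0"
  have "\<exists>D::int. D > 0 \<and> of_int D * (of_rat r :: real) \<in> \<int>" for r
  proof (cases r)
    case (Fract p D)
    then show ?thesis by (intro exI[of _ D]) (simp add: of_rat_rat)
  qed
  then obtain D where D: "\<And>r. (D r::int) > 0" "\<And>r. of_int (D r) * (of_rat r :: real) \<in> \<int>"
    by metis
  \<comment> \<open>Clearing denominators turns a rational relation into an integral one.\<close>
  define E where "E = real_of_int (D a * D b * D c)"
  have "E \<noteq> 0" using D(1)[of a] D(1)[of b] D(1)[of c] by (simp add: E_def)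
  have E: "E * of_rat a \<in> \<int>" "E * of_rat b \<in> \<int>" "E * of_rat c \<in> \<int>"
    using Ints_mult[OF D(2)[of a] Ints_of_int[of "D b * D c"]]
      Ints_mult[OF D(2)[of b] Ints_of_int[of "D a * D c"]]
      Ints_mult[OF D(2)[of c] Ints_of_int[of "D a * D b"]]
    by (simp_all add: E_def mult_ac)
  let ?n = "vector [E * of_rat a, E * of_rat b, E * of_rat c] :: real^3"
  have "?n \<bullet> x = E * (of_rat a * x $ 1 + of_rat b * x $ 2 + of_rat c * x $ 3)"
    by (simp add: inner_3 algebra_simps)
  then have "?n = 0"
    using h E by (intro integral_relation_trivial[OF assms]) (simp_all add: forall_3)
  then show "a = 0 \<and> b = 0 \<and> c = 0"
    using \<open>E \<noteq> 0\<close> by (simp add: vec_eq_iff forall_3)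
qed

text \<open>Along equal-symbol blocks the middle entry is constant and the sum of the outer ones
  drops by at least that entry per block. Independence makes the entry nonzero, so the sum would
  become negative.\<close>

lemma rat_indep_parity_defects:
  assumes ind: "rat_indep x" and x: "x \<in> limit_cone i"
  shows "parity_defects i"
proof (rule ccontr)
  assume "\<not> parity_defects i"
  then obtain r where r: "\<And>k. (i (r + 2 * k) = 1) = (i (Suc (r + 2 * k)) = 1)"
    unfolding parity_defects_def by blast
  define y where "y = (\<lambda>k. orb i x (r + 2 * k))"
  have nn: "0 \<le> y k $ 1 \<and> 0 \<le> y k $ 2 \<and> 0 \<le> y k $ 3" for k
    using x by (simp add: y_def mem_limit_cone mem_nonneg_cone)
  have "rat_indep (y 0)" by (simp add: y_def rat_indep_orb ind)
  then have "y 0 $ 2 \<noteq> 0"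
    unfolding rat_indep_def by (force dest: spec[of _ 0] spec[of _ 1])
  then have y2: "0 < y 0 $ 2" using nn[of 0] by simp
  have "y k $ 2 = y 0 $ 2 \<and> y k $ 1 + y k $ 3 \<le> y 0 $ 1 + y 0 $ 3 - k * y 0 $ 2" for k
  proof (induction k)
    case (Suc k)
    have "y (Suc k) = pull (i (Suc (r + 2 * k))) (pull (i (r + 2 * k)) (y k))" by (simp add: y_def)
    then show ?case using Suc r[of k] nn[of k] by (simp add: pull_def algebra_simps)
  qed simp
  then have "k * y 0 $ 2 \<le> y 0 $ 1 + y 0 $ 3" for k :: nat
    using nn[of k] by (smt (verit))
  moreover obtain k :: nat where "y 0 $ 1 + y 0 $ 3 < k * y 0 $ 2"
    using reals_Archimedean3[OF y2] by blast
  ultimately show False by (meson not_less)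
qed

section \<open>Itineraries\<close>

definition itinerary :: "real^3 \<Rightarrow> nat \<Rightarrow> nat" where
  "itinerary x k = (if (f_C ^^ k) x $ 1 \<ge> (f_C ^^ k) x $ 3 then 1 else 2)"

lemma F_C_eq_pull: "F_C x = pull (if x $ 1 \<ge> x $ 3 then 1 else 2) x"
  by (simp add: F_C_coordinates pull_def)

lemma F_C_simplex3:
  assumes "x \<in> simplex3"
  shows "F_C x \<in> nonneg_cone" "F_C x \<noteq> 0"
  using assms by (auto simp: F_C_coordinates mem_simplex3 mem_nonneg_cone vec_eq_iff forall_3)

lemma f_C_simplex3: "x \<in> simplex3 \<Longrightarrow> f_C x \<in> simplex3"
  unfolding f_C_def by (intro normalize_simplex3 F_C_simplex3)

lemma itinerary_seqs12: "itinerary x \<in> seqs12"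
  by (simp add: seqs12_def itinerary_def Pi_def)

text \<open>The linear orbit and the \<open>f_C\<close> orbit differ only by the positive factors
  lost in normalizing.\<close>

lemma orb_itinerary:
  assumes "x \<in> simplex3"
  shows "(f_C ^^ k) x \<in> simplex3 \<and> (\<exists>t>0. orb (itinerary x) x k = t *\<^sub>R (f_C ^^ k) x)"
proof (induction k)
  case 0
  show ?case using assms by (auto intro: exI[of _ 1])
next
  case (Suc k)
  let ?y = "(f_C ^^ k) x"
  obtain t where t: "t > 0" "orb (itinerary x) x k = t *\<^sub>R ?y" and y: "?y \<in> simplex3"
    using Suc by blast
  have l: "0 < l1_norm (F_C ?y)" using normalize_simplex3 F_C_simplex3 y by blast
  have "orb (itinerary x) x (Suc k) = t *\<^sub>R F_C ?y"
    by (simp add: t pull_scaleR F_C_eq_pull itinerary_def)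
  also have "\<dots> = (t * l1_norm (F_C ?y)) *\<^sub>R (f_C ^^ Suc k) x"
    using l by (simp add: f_C_def)
  finally show ?case using t(1) l y f_C_simplex3[OF y] by (auto intro!: exI[of _ "t * l1_norm (F_C ?y)"])
qed

lemma itinerary_limit_cone:
  assumes "x \<in> simplex3"
  shows "x \<in> limit_cone (itinerary x)"
  unfolding mem_limit_cone
proof
  fix k
  obtain t where "t > 0" "orb (itinerary x) x k = t *\<^sub>R (f_C ^^ k) x" "(f_C ^^ k) x \<in> simplex3"
    using orb_itinerary[OF assms] by blast
  then show "orb (itinerary x) x k \<in> nonneg_cone" by (simp add: mem_simplex3 mem_nonneg_cone)
qed

lemma pi_map_itinerary: "x \<in> simplex3 \<Longrightarrow> pi_map (itinerary x) = x"
  by (intro pi_map_eqI itinerary_limit_cone)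

lemma pi_map_nonzero: "pi_map i \<noteq> 0"
  using pi_map_simplex3[of i] by (auto simp: mem_simplex3)

lemma pi_map_rat_indep: "i \<in> primitive_seqs \<Longrightarrow> pi_map i \<in> rat_indep_simplex"
  using rat_indep_limit_cone[of i "pi_map i"] pi_map_limit_cone pi_map_simplex3 pi_map_nonzero
  by (simp add: primitive_seqs_eq rat_indep_simplex_eq)

lemma itinerary_primitive: "x \<in> rat_indep_simplex \<Longrightarrow> itinerary x \<in> primitive_seqs"
  using rat_indep_parity_defects[of x "itinerary x"] itinerary_limit_cone itinerary_seqs12
  by (simp add: primitive_seqs_eq rat_indep_simplex_eq)

lemma seqs12_shift: "i \<in> seqs12 \<Longrightarrow> shift_map i \<in> seqs12"
  by (auto simp: seqs12_def shift_map_def)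

lemma primitive_seqs_shift: "i \<in> primitive_seqs \<Longrightarrow> shift_map i \<in> primitive_seqs"
  using parity_defects_shift[of i 1] seqs12_shift[of i]
  by (simp add: primitive_seqs_eq shift_map_def)

text \<open>By \<open>orb_pos\<close> the first pulled-back point has positive entries, so the
  difference of \<open>pi_map i $ 1\<close> and \<open>pi_map i $ 3\<close> is nonzero and its sign
  reveals the symbol.\<close>

lemma first_symbol:
  assumes "i \<in> primitive_seqs"
  shows "i 0 = (if pi_map i $ 1 \<ge> pi_map i $ 3 then 1 else 2)"
proof -
  have i: "i 0 = 1 \<or> i 0 = 2" "parity_defects i"
    using assms by (auto simp: primitive_seqs_eq seqs12_def Pi_def)
  have "0 < pull (i 0) (pi_map i) $ j" for j
    using orb_pos[OF i(2) pi_map_limit_cone pi_map_nonzero, of 1 j] by simp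
  from this[of 1] this[of 3] show ?thesis using i(1) by (auto simp: pull_def)
qed

lemma pi_map_shift:
  assumes "i \<in> primitive_seqs"
  shows "pi_map (shift_map i) = f_C (pi_map i)"
proof (rule pi_map_eqI)
  have "F_C (pi_map i) = pull (i 0) (pi_map i)"
    using first_symbol[OF assms] by (simp add: F_C_eq_pull)
  then have "orb (shift_map i) (F_C (pi_map i)) k = orb i (pi_map i) (Suc k)" for k
    by (simp only: orb_Suc_shift)
  moreover have "orb i (pi_map i) (Suc k) \<in> nonneg_cone" for k
    using pi_map_limit_cone mem_limit_cone by blast
  ultimately show "f_C (pi_map i) \<in> limit_cone (shift_map i)"
    by (simp add: mem_limit_cone f_C_def orb_scaleR nonneg_cone_def l1_norm_def sum_nonneg
        del: orb.simps)
  show "f_C (pi_map i) \<in> simplex3" by (intro f_C_simplex3 pi_map_simplex3)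
qed

lemma itinerary_pi_map:
  assumes "i \<in> primitive_seqs"
  shows "itinerary (pi_map i) = i"
proof
  fix k
  have shift: "(shift_map ^^ k) i 0 = i k" for k and i :: "nat \<Rightarrow> nat"
    by (induction k arbitrary: i) (simp_all add: funpow_Suc_right shift_map_def del: funpow.simps(2))
  have "(f_C ^^ k) (pi_map i) = pi_map ((shift_map ^^ k) i) \<and> (shift_map ^^ k) i \<in> primitive_seqs"
    by (induction k) (simp_all add: assms pi_map_shift primitive_seqs_shift)
  then show "itinerary (pi_map i) k = i k"
    using first_symbol[of "(shift_map ^^ k) i"] shift[of k i] by (simp add: itinerary_def)
qed

lemma inj_on_pi_map: "inj_on pi_map primitive_seqs"
  by (rule inj_on_inverseI[of _ itinerary]) (rule itinerary_pi_map)

lemma bij_betw_pi_map: "bij_betw pi_map primitive_seqs rat_indep_simplex"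
  by (rule bij_betw_byWitness[where f' = itinerary])
    (use pi_map_rat_indep itinerary_primitive in
      \<open>auto simp: itinerary_pi_map pi_map_itinerary rat_indep_simplex_eq\<close>)

lemma the_inv_into_pi_map:
  "x \<in> rat_indep_simplex \<Longrightarrow> the_inv_into primitive_seqs pi_map x = itinerary x"
  by (rule the_inv_into_f_eq[OF inj_on_pi_map])
    (auto simp: itinerary_primitive pi_map_itinerary rat_indep_simplex_eq)

lemma f_C_rat_indep_simplex: "f_C ` rat_indep_simplex \<subseteq> rat_indep_simplex"
  using bij_betw_imp_surj_on[OF bij_betw_pi_map] pi_map_shift primitive_seqs_shift
  by (metis (no_types, lifting) image_iff image_subsetI pi_map_rat_indep)

section \<open>Measurability\<close>

lemma borel_measurable_pull [measurable]: "pull a \<in> borel_measurable borel"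
  by (intro borel_measurable_continuous_onI continuous_pull)

lemma borel_measurable_f_C [measurable]: "f_C \<in> borel_measurable borel"
proof -
  have [measurable]: "l1_norm \<in> borel_measurable borel"
    by (intro borel_measurable_continuous_onI continuous_l1_norm)
  have [measurable]: "(\<lambda>x::real^3. x $ j) \<in> borel_measurable borel" for j
    by (intro borel_measurable_continuous_onI continuous_intros)
  have F_C: "F_C = (\<lambda>x. if x $ 3 \<le> x $ 1 then pull 1 x else pull 2 x)"
    by (auto simp: F_C_eq_pull)
  have [measurable]: "F_C \<in> borel_measurable borel" unfolding F_C by measurable
  show ?thesis unfolding f_C_def[abs_def] by measurable
qed

lemma measurable_f_C: "f_C \<in> measurable simplex_borel simplex_borel"
  unfolding simplex_borel_def
  by (intro measurable_restrict_space3 borel_measurable_f_C) (auto intro: f_C_simplex3)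

lemma borel_measurable_shift [measurable]: "shift_map \<in> borel_measurable borel"
  unfolding shift_map_def[abs_def]
  by (intro borel_measurable_continuous_onI continuous_on_coordinatewise_then_product) simp

lemma measurable_shift: "shift_map \<in> measurable seqs12_borel seqs12_borel"
  unfolding seqs12_borel_def
  by (intro measurable_restrict_space3 borel_measurable_shift) (auto intro: seqs12_shift)

text \<open>The discrete target lets conditions such as \<open>i 0 = 1\<close> be handled by
  \<open>measurable\<close>.\<close>

lemma measurable_coordinate [measurable]:
  "(\<lambda>i::nat \<Rightarrow> nat. i k) \<in> measurable borel (count_space UNIV)"
proof -
  have "(\<lambda>i::nat \<Rightarrow> nat. i k) \<in> borel_measurable borel"
    by (intro borel_measurable_continuous_onI) simp
  then show ?thesis by (simp add: measurable_cong_sets[OF refl sets_borel_eq_count_space])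
qed

lemma borel_measurable_approx [measurable]: "approx k \<in> borel_measurable borel"
proof (induction k)
  case (Suc k)
  note Suc [measurable]
  have mult: "(\<lambda>x. A *v x) \<in> borel_measurable borel" for A :: "real^3^3"
    by (intro borel_measurable_continuous_onI matrix_vector_mult_linear_continuous_on)
  note mult[of C1, measurable] mult[of C2, measurable]
  have "approx (Suc k) = (\<lambda>i. if i 0 = 1 then C1 *v approx k (shift_map i)
      else C2 *v approx k (shift_map i))"
    by (auto simp: C_mat_def)
  then show ?case by simp
next
  case 0
  have "approx 0 = (\<lambda>i. 1)" by auto
  then show ?case by simp
qed

lemma measurable_pi_map: "pi_map \<in> measurable seqs12_borel simplex_borel"
  unfolding simplex_borel_def
proof (rule measurable_restrict_space2)
  have [measurable]: "l1_norm \<in> borel_measurable borel"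
    by (intro borel_measurable_continuous_onI continuous_l1_norm)
  have "approx_simplex k \<in> borel_measurable borel" for k
    unfolding approx_simplex_def[abs_def] by measurable
  then have "pi_map \<in> borel_measurable borel"
    by (rule borel_measurable_LIMSEQ_metric) (rule approx_simplex_tendsto)
  then show "pi_map \<in> borel_measurable seqs12_borel"
    unfolding seqs12_borel_def by (rule measurable_restrict_space1)
qed (simp add: pi_map_simplex3)

lemma measurable_itinerary: "itinerary \<in> measurable simplex_borel seqs12_borel"
  unfolding seqs12_borel_def
proof (rule measurable_restrict_space2)
  have [measurable]: "f_C ^^ k \<in> borel_measurable borel" for k
    by (induction k) (auto simp: o_def)
  have [measurable]: "(\<lambda>x::real^3. x $ j) \<in> borel_measurable borel" for j
    by (intro borel_measurable_continuous_onI continuous_intros)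
  have "(\<lambda>x. itinerary x k) \<in> borel_measurable borel" for k
    unfolding itinerary_def by measurable
  then have "itinerary \<in> borel_measurable borel"
    by (rule measurable_coordinatewise_then_product)
  then show "itinerary \<in> borel_measurable simplex_borel"
    unfolding simplex_borel_def by (rule measurable_restrict_space1)
qed (simp add: itinerary_seqs12)

lemma sets_primitive_seqs: "primitive_seqs \<in> sets seqs12_borel"
proof -
  have "{i \<in> space borel. parity_defects i} \<in> sets borel"
    unfolding parity_defects_def by measurable
  then have "seqs12 \<inter> {i \<in> space borel. parity_defects i} \<in> sets seqs12_borel"
    unfolding seqs12_borel_def sets_restrict_space by (rule imageI)
  then show ?thesis by (simp add: primitive_seqs_eq Collect_conj_eq)
qed

lemma sets_rat_indep_simplex: "rat_indep_simplex \<in> sets simplex_borel"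
proof -
  have [measurable]: "(\<lambda>x::real^3. x $ j) \<in> borel_measurable borel" for j
    by (intro borel_measurable_continuous_onI continuous_intros)
  have "{x \<in> space borel. rat_indep x} \<in> sets borel"
    unfolding rat_indep_def by measurable
  then have "simplex3 \<inter> {x \<in> space borel. rat_indep x} \<in> sets simplex_borel"
    unfolding simplex_borel_def sets_restrict_space by (rule imageI)
  then show ?thesis by (simp add: rat_indep_simplex_eq Collect_conj_eq)
qed

lemma space_simplex_borel: "space simplex_borel = simplex3"
  by (simp add: simplex_borel_def space_restrict_space)

lemma measurable_the_inv_into_pi_map:
  "the_inv_into primitive_seqs pi_map \<in>
     measurable (restrict_space simplex_borel rat_indep_simplex) (restrict_space seqs12_borel primitive_seqs)"
proof -
  have "itinerary \<in> measurable (restrict_space simplex_borel rat_indep_simplex)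
      (restrict_space seqs12_borel primitive_seqs)"
    by (intro measurable_restrict_space3 measurable_itinerary) (auto intro: itinerary_primitive)
  then show ?thesis
    by (subst measurable_cong[where g = itinerary])
      (auto simp: space_restrict_space the_inv_into_pi_map)
qed

section \<open>Transport of invariant measures\<close>

lemma AE_emeasure_eq_1:
  assumes "prob_space M" "A \<in> sets M" "emeasure M A = 1"
  shows "AE x in M. x \<in> A"
  using prob_space.AE_in_set_eq_1[OF assms(1,2)] assms(3)
  by (simp add: measure_def)

lemma distr_restrict_space_full:
  assumes M: "prob_space M" "A \<in> sets M" "emeasure M A = 1" and f: "f \<in> measurable M N"
  shows "distr (restrict_space M A) N f = distr M N f"
proof (rule measure_eqI)
  fix B assume "B \<in> sets (distr (restrict_space M A) N f)"
  then have B: "B \<in> sets N" by simp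
  have "emeasure (distr (restrict_space M A) N f) B =
      emeasure (restrict_space M A) (f -` B \<inter> space (restrict_space M A))"
    using f B by (simp add: emeasure_distr measurable_restrict_space1)
  also have "\<dots> = emeasure M (f -` B \<inter> space (restrict_space M A))"
    using M by (intro emeasure_restrict_space) (auto simp: space_restrict_space)
  also have "\<dots> = emeasure M (f -` B \<inter> space M)"
  proof (rule emeasure_eq_AE)
    show "AE x in M. x \<in> f -` B \<inter> space (restrict_space M A) \<longleftrightarrow> x \<in> f -` B \<inter> space M"
      using AE_emeasure_eq_1[OF M] by eventually_elim (auto simp: space_restrict_space)
    show "f -` B \<inter> space M \<in> sets M" using f B by (rule measurable_sets)
    moreover have "f -` B \<inter> space (restrict_space M A) = (f -` B \<inter> space M) \<inter> A"
      by (auto simp: space_restrict_space)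
    ultimately show "f -` B \<inter> space (restrict_space M A) \<in> sets M" using M(2) by simp
  qed
  also have "\<dots> = emeasure (distr M N f) B" using f B by (simp add: emeasure_distr)
  finally show "emeasure (distr (restrict_space M A) N f) B = emeasure (distr M N f) B" .
qed simp

lemma mp_isomorphism_pi_push:
  fixes \<mu> :: "(nat \<Rightarrow> nat) measure"
  assumes sets: "sets \<mu> = sets seqs12_borel" and prob: "prob_space \<mu>"
    and inv: "invariant_measure \<mu> shift_map" and full: "emeasure \<mu> primitive_seqs = 1"
  shows "mp_isomorphism \<mu> shift_map (pi_push \<mu>) f_C pi_map"
proof -
  interpret \<mu>: prob_space \<mu> by (rule prob)
  let ?P = primitive_seqs and ?I = rat_indep_simplex and ?N = "pi_push \<mu>"
  have setsN: "sets ?N = sets simplex_borel" by (simp add: pi_push_def)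
  have P: "?P \<in> sets \<mu>" and I: "?I \<in> sets ?N"
    by (simp_all add: sets setsN sets_primitive_seqs sets_rat_indep_simplex)
  have pi: "pi_map \<in> measurable \<mu> simplex_borel"
    using measurable_pi_map by (simp add: measurable_cong_sets[OF sets refl])
  have f: "f_C \<in> measurable ?N ?N"
    using measurable_f_C by (simp add: measurable_cong_sets[OF setsN setsN])
  have AE: "AE i in \<mu>. i \<in> ?P" by (rule AE_emeasure_eq_1[OF prob P full])
  have probN: "prob_space ?N" unfolding pi_push_def by (rule \<mu>.prob_space_distr[OF pi])
  have shift: "shift_map \<in> measurable \<mu> \<mu>" "distr \<mu> \<mu> shift_map = \<mu>"
    using inv by (auto simp: invariant_measure_def)
  have "distr ?N ?N f_C = distr ?N simplex_borel f_C"
    by (intro distr_cong) (simp_all add: setsN)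
  also have "\<dots> = distr \<mu> simplex_borel (f_C \<circ> pi_map)"
    unfolding pi_push_def by (intro distr_distr measurable_f_C pi)
  \<comment> \<open>The conjugacy is available on \<open>primitive_seqs\<close>, hence almost
    everywhere, which suffices for equal pushforwards.\<close>
  also have "\<dots> = distr \<mu> simplex_borel (pi_map \<circ> shift_map)"
  proof (rule distr_cong_AE)
    show "AE i in \<mu>. (f_C \<circ> pi_map) i = (pi_map \<circ> shift_map) i"
      using AE by eventually_elim (simp add: pi_map_shift)
  qed (use pi measurable_f_C shift(1) in \<open>auto intro: measurable_comp\<close>)
  also have "\<dots> = distr (distr \<mu> \<mu> shift_map) simplex_borel pi_map"
    by (intro distr_distr[symmetric] pi shift)
  also have "\<dots> = ?N" by (simp add: shift(2) pi_push_def)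
  finally have invN: "invariant_measure ?N f_C" using f by (simp add: invariant_measure_def)
  have "emeasure ?N ?I = emeasure \<mu> (pi_map -` ?I \<inter> space \<mu>)"
    unfolding pi_push_def by (intro emeasure_distr pi sets_rat_indep_simplex)
  also have "\<dots> = emeasure \<mu> ?P"
    using AE pi_map_rat_indep AE_space[of \<mu>] P measurable_sets[OF pi sets_rat_indep_simplex]
    by (intro emeasure_eq_AE) auto
  finally have fullN: "emeasure ?N ?I = 1" by (simp add: full)
  have piN: "pi_map \<in> measurable \<mu> ?N"
    using pi by (simp add: measurable_cong_sets[OF refl setsN])
  have pi': "pi_map \<in> measurable (restrict_space \<mu> ?P) (restrict_space ?N ?I)"
    by (intro measurable_restrict_space3 piN) (auto intro: pi_map_rat_indep)
  have "sets (restrict_space \<mu> ?P) = sets (restrict_space seqs12_borel ?P)"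
    "sets (restrict_space ?N ?I) = sets (restrict_space simplex_borel ?I)"
    by (simp_all add: sets_restrict_space sets setsN)
  then have inv_meas: "the_inv_into ?P pi_map \<in> measurable (restrict_space ?N ?I) (restrict_space \<mu> ?P)"
    using measurable_the_inv_into_pi_map measurable_cong_sets by blast
  have push: "distr (restrict_space \<mu> ?P) (restrict_space ?N ?I) pi_map = restrict_space ?N ?I"
  proof (rule measure_eqI)
    fix B assume "B \<in> sets (distr (restrict_space \<mu> ?P) (restrict_space ?N ?I) pi_map)"
    then have B: "B \<in> sets (restrict_space ?N ?I)" by simp
    then have B': "B \<subseteq> ?I" "B \<in> sets simplex_borel"
      using I by (auto simp: sets_restrict_space_iff setsN)
    have "emeasure (distr (restrict_space \<mu> ?P) (restrict_space ?N ?I) pi_map) B =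
        emeasure (restrict_space \<mu> ?P) (pi_map -` B \<inter> space (restrict_space \<mu> ?P))"
      using pi' B by (rule emeasure_distr)
    also have "\<dots> = emeasure (distr (restrict_space \<mu> ?P) simplex_borel pi_map) B"
      using pi B' by (simp add: emeasure_distr measurable_restrict_space1)
    also have "\<dots> = emeasure ?N B"
      by (simp add: distr_restrict_space_full[OF prob P full pi] pi_push_def)
    also have "\<dots> = emeasure (restrict_space ?N ?I) B"
      using I B' by (simp add: emeasure_restrict_space)
    finally show "emeasure (distr (restrict_space \<mu> ?P) (restrict_space ?N ?I) pi_map) B =
      emeasure (restrict_space ?N ?I) B" .
  qed simp
  show ?thesis
    unfolding mp_isomorphism_def mp_system_def
  proof (intro conjI prob inv probN invN bexI[OF _ I] bexI[OF _ P] full fullN pi' inv_meas push ballI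
      bij_betw_pi_map f_C_rat_indep_simplex)
    show "pi_map \<in> space \<mu> \<rightarrow> space ?N" using measurable_space[OF piN] by auto
    show "shift_map ` ?P \<subseteq> ?P" using primitive_seqs_shift by auto
  qed (rule pi_map_shift)
qed

text \<open>On the full-measure set \<open>rat_indep_simplex\<close> the inverse of
  \<open>pi_map\<close> is \<open>itinerary\<close>, so \<open>pi_inv_push \<nu>\<close> is the
  pushforward of \<open>\<nu>\<close> under a map that is measurable on the whole simplex.\<close>

lemma pi_inv_push:
  fixes \<nu> :: "(real^3) measure"
  assumes sets: "sets \<nu> = sets simplex_borel" and prob: "prob_space \<nu>"
    and inv: "invariant_measure \<nu> f_C" and full: "emeasure \<nu> rat_indep_simplex = 1"
  shows pi_push_pi_inv_push: "pi_push (pi_inv_push \<nu>) = \<nu>"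
    and prob_space_pi_inv_push: "prob_space (pi_inv_push \<nu>)"
    and emeasure_pi_inv_push: "emeasure (pi_inv_push \<nu>) primitive_seqs = 1"
    and invariant_pi_inv_push: "invariant_measure (pi_inv_push \<nu>) shift_map"
proof -
  interpret \<nu>: prob_space \<nu> by (rule prob)
  let ?I = rat_indep_simplex and ?\<mu> = "distr \<nu> seqs12_borel itinerary"
  have I: "?I \<in> sets \<nu>" by (simp add: sets sets_rat_indep_simplex)
  have it: "itinerary \<in> measurable \<nu> seqs12_borel"
    using measurable_itinerary by (simp add: measurable_cong_sets[OF sets refl])
  have AE: "AE x in \<nu>. x \<in> ?I" by (rule AE_emeasure_eq_1[OF prob I full])
  have f: "f_C \<in> measurable \<nu> \<nu>" "distr \<nu> \<nu> f_C = \<nu>"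
    using inv by (auto simp: invariant_measure_def)
  have "pi_inv_push \<nu> = distr (restrict_space \<nu> ?I) seqs12_borel itinerary"
    unfolding pi_inv_push_def
    by (intro distr_cong) (auto simp: space_restrict_space the_inv_into_pi_map)
  also have "\<dots> = ?\<mu>" by (rule distr_restrict_space_full[OF prob I full it])
  finally have eq: "pi_inv_push \<nu> = ?\<mu>" .
  show "prob_space (pi_inv_push \<nu>)" unfolding eq by (rule \<nu>.prob_space_distr[OF it])
  have "pi_push ?\<mu> = distr \<nu> simplex_borel (pi_map \<circ> itinerary)"
    unfolding pi_push_def by (intro distr_distr measurable_pi_map it)
  also have "\<dots> = distr \<nu> \<nu> (\<lambda>x. x)"
    using sets_eq_imp_space_eq[OF sets]
    by (intro distr_cong) (auto simp: sets space_simplex_borel pi_map_itinerary)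
  finally show "pi_push (pi_inv_push \<nu>) = \<nu>" by (simp add: eq)
  have "emeasure ?\<mu> primitive_seqs = emeasure \<nu> (itinerary -` primitive_seqs \<inter> space \<nu>)"
    by (intro emeasure_distr it sets_primitive_seqs)
  also have "\<dots> = emeasure \<nu> ?I"
    using AE itinerary_primitive AE_space[of \<nu>] I measurable_sets[OF it sets_primitive_seqs]
    by (intro emeasure_eq_AE) auto
  finally show "emeasure (pi_inv_push \<nu>) primitive_seqs = 1" by (simp add: eq full)
  \<comment> \<open>Unlike the conjugacy for \<open>pi_map\<close>, this one holds at every point,
    so no almost-everywhere argument is required.\<close>
  have commute: "shift_map (itinerary x) = itinerary (f_C x)" for x
    by (rule ext) (simp add: shift_map_def itinerary_def funpow_swap1)
  have "distr ?\<mu> ?\<mu> shift_map = distr ?\<mu> seqs12_borel shift_map"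
    by (intro distr_cong) simp_all
  also have "\<dots> = distr \<nu> seqs12_borel (shift_map \<circ> itinerary)"
    by (intro distr_distr measurable_shift it)
  also have "\<dots> = distr \<nu> seqs12_borel (itinerary \<circ> f_C)"
    by (simp add: o_def commute)
  also have "\<dots> = distr (distr \<nu> \<nu> f_C) seqs12_borel itinerary"
    by (intro distr_distr[symmetric] it f)
  finally have "distr ?\<mu> ?\<mu> shift_map = ?\<mu>" by (simp add: f(2))
  then show "invariant_measure (pi_inv_push \<nu>) shift_map"
    using measurable_shift by (simp add: invariant_measure_def eq)
qed

theorem theorem1:
  shows "(\<forall>\<mu> :: (nat \<Rightarrow> nat) measure.
            sets \<mu> = sets seqs12_borel \<and> prob_space \<mu> \<and> invariant_measure \<mu> shift_map \<and>
            emeasure \<mu> primitive_seqs = 1 \<longrightarrow>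
            mp_isomorphism \<mu> shift_map (pi_push \<mu>) f_C pi_map) \<and>
         (\<forall>\<nu> :: (real^3) measure.
            sets \<nu> = sets simplex_borel \<and> prob_space \<nu> \<and> invariant_measure \<nu> f_C \<and>
            emeasure \<nu> rat_indep_simplex = 1 \<longrightarrow>
            mp_isomorphism (pi_inv_push \<nu>) shift_map \<nu> f_C pi_map)"
proof (intro conjI allI impI)
  fix \<mu> :: "(nat \<Rightarrow> nat) measure"
  assume "sets \<mu> = sets seqs12_borel \<and> prob_space \<mu> \<and> invariant_measure \<mu> shift_map \<and>
    emeasure \<mu> primitive_seqs = 1"
  then show "mp_isomorphism \<mu> shift_map (pi_push \<mu>) f_C pi_map"
    by (intro mp_isomorphism_pi_push) simp_all
next
  fix \<nu> :: "(real^3) measure"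
  assume "sets \<nu> = sets simplex_borel \<and> prob_space \<nu> \<and> invariant_measure \<nu> f_C \<and>
    emeasure \<nu> rat_indep_simplex = 1"
  then have \<nu>: "sets \<nu> = sets simplex_borel" "prob_space \<nu>" "invariant_measure \<nu> f_C"
    "emeasure \<nu> rat_indep_simplex = 1" by simp_all
  have "sets (pi_inv_push \<nu>) = sets seqs12_borel" by (simp add: pi_inv_push_def)
  \<comment> \<open>The second claim is the first one for \<open>pi_inv_push \<nu>\<close>, whose
    image under \<open>pi_push\<close> is \<open>\<nu>\<close> again.\<close>
  then have "mp_isomorphism (pi_inv_push \<nu>) shift_map (pi_push (pi_inv_push \<nu>)) f_C pi_map"
    by (intro mp_isomorphism_pi_push prob_space_pi_inv_push[OF \<nu>] emeasure_pi_inv_push[OF \<nu>]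
        invariant_pi_inv_push[OF \<nu>])
  then show "mp_isomorphism (pi_inv_push \<nu>) shift_map \<nu> f_C pi_map"
    by (simp only: pi_push_pi_inv_push[OF \<nu>])
qed

end
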